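(* Let $G=(V,E)$ be a graph with $n$ vertices (possibly directed and with positive edge weights). Let $f$ and $L$ be positive integers, which may depend on $n$, such that $f=o(\log L)$. Then there exists a deterministic $(L,f)$-replacement path covering for $G$ with covering value $\widetilde{O}(fL^{f+o(1)})$ and query time $\widetilde{O}(f^{5/2}L^{o(1)})$, and for every failure set $F$ the computed subfamily $\mathcal{G}_F$ has size $\widetilde{O}(fL^{o(1)})$. Moreover, for sensitivities up to $f=o(\log n)$, there is such a deterministic $(L,f)$-replacement path covering with covering value $L^{f}n^{o(1)}$, and the query time as well as the size of $\mathcal{G}_F$ are $n^{o(1)}$.
   Context: For a graph $G=(V,E)$ and a set $F\subseteq E$, $G-F$ denotes the graph with the edges of $F$ removed. Let $L,f$ be positive integers. An $(L,f)$-replacement path covering for $G$ is a family $\mathcal{G}$ of spanning subgraphs of $G$ together with, for every set $F\subseteq E$ with $|F|\le f$, a subfamily $\mathcal{G}_F\subseteq\mathcal{G}$ such that: (1) no subgraph in $\mathcal{G}_F$ contains an edge of $F$; (2) for all $s,t\in V$ such that there exists a shortest path from $s$ to $t$ in $G-F$ with at most $L$ edges, at least one subgraph in $\mathcal{G}_F$ also contains such a path (a shortest $s$-$t$ path of $G-F$ with at most $L$ edges). The covering value is $|\mathcal{G}|$; the query time is the time needed to compute $\mathcal{G}_F$ from $F$. The notation $\widetilde{O}(g)$ means $O(g\cdot \mathrm{polylog}(n))$. *)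

theory Defs
  imports
    "Graph_Theory.Pair_Digraph"
    "Graph_Theory.Weighted_Graph"
    "HOL-Library.Landau_Symbols"
begin

section \<open>Graphs, edge failures and shortest paths\<close>

text \<open>
  A simple graph on the vertices \<open>0, \<dots>, n - 1\<close>. In a directed graph an edge is an ordered pair.
  In an undirected graph the edge joining \<open>u < v\<close> is the single pair \<open>(u, v)\<close>, so that it counts
  (and fails) as one edge although it can be traversed in both directions.
\<close>

record wgraph =
  nverts :: nat
  directed :: bool
  edges :: "(nat \<times> nat) set"
  weight :: "nat \<times> nat \<Rightarrow> real"

definition wf_wgraph :: "wgraph \<Rightarrow> bool" where
  "wf_wgraph G \<longleftrightarrow>
     (\<forall>(u, v) \<in> edges G. u < nverts G \<and> v < nverts G \<and> u \<noteq> v \<and> (\<not> directed G \<longrightarrow> u < v)) \<and>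
     (\<forall>e \<in> edges G. weight G e > 0)"

text \<open>The spanning subgraph of \<open>G\<close> with edge set \<open>A\<close>, as a digraph of traversable arcs.\<close>

definition spanning_sub :: "wgraph \<Rightarrow> (nat \<times> nat) set \<Rightarrow> nat pair_pre_digraph" where
  "spanning_sub G A =
     \<lparr> pverts = {..<nverts G}, parcs = (if directed G then A else A \<union> A\<inverse>) \<rparr>"

definition arc_weight :: "wgraph \<Rightarrow> nat \<times> nat \<Rightarrow> real" where
  "arc_weight G = (\<lambda>(u, v). if directed G then weight G (u, v) else weight G (min u v, max u v))"

definition path_in :: "nat pair_pre_digraph \<Rightarrow> nat \<Rightarrow> (nat \<times> nat) list \<Rightarrow> nat \<Rightarrow> bool" where
  "path_in D s p t \<longleftrightarrow> pre_digraph.apath (with_proj D) s p t"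

definition shortest_path ::
    "nat pair_pre_digraph \<Rightarrow> (nat \<times> nat \<Rightarrow> real) \<Rightarrow> nat \<Rightarrow> (nat \<times> nat) list \<Rightarrow> nat \<Rightarrow> bool" where
  "shortest_path D c s p t \<longleftrightarrow>
     path_in D s p t \<and>
     (\<forall>q. path_in D s q t \<longrightarrow> wf_digraph.awalk_cost c p \<le> wf_digraph.awalk_cost c q)"

section \<open>Replacement path coverings\<close>

text \<open>
  The family consists of the \<open>K\<close> spanning subgraphs with edge sets \<open>H 0, \<dots>, H (K - 1)\<close>; its
  subfamily for the failure set \<open>F\<close> is given by the set \<open>S F\<close> of indices.
\<close>

definition replacement_path_covering ::
    "wgraph \<Rightarrow> nat \<Rightarrow> nat \<Rightarrow> nat \<Rightarrow> (nat \<Rightarrow> (nat \<times> nat) set) \<Rightarrow> ((nat \<times> nat) set \<Rightarrow> nat set) \<Rightarrow> bool"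
  where
  "replacement_path_covering G L f K H S \<longleftrightarrow>
     (\<forall>i<K. H i \<subseteq> edges G) \<and>
     (\<forall>F. F \<subseteq> edges G \<and> card F \<le> f \<longrightarrow>
        S F \<subseteq> {..<K} \<and>
        (\<forall>i \<in> S F. H i \<inter> F = {}) \<and>
        (\<forall>s<nverts G. \<forall>t<nverts G.
           (\<exists>p. shortest_path (spanning_sub G (edges G - F)) (arc_weight G) s p t \<and> length p \<le> L) \<longrightarrow>
           (\<exists>i \<in> S F. \<exists>p. shortest_path (spanning_sub G (edges G - F)) (arc_weight G) s p t \<and>
              length p \<le> L \<and> path_in (spanning_sub G (H i)) s p t)))"

section \<open>Query time on a word RAM\<close>

text \<open>
  A deterministic word RAM with word length \<open>w\<close>, unit-cost instructions, registers, a
  random-access memory and a write-only output. It halts when the program counter leaves the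
  program. Subtraction is truncated at 0 and division by 0 follows the HOL convention.
\<close>

datatype ram_op = Add | Sub | Mul | Quo | Rem

datatype ram_instr =
    Const nat nat
  | Arith ram_op nat nat nat
  | Load nat nat
  | Store nat nat
  | Jump nat
  | JumpZero nat nat
  | Emit nat

record ram_state =
  pc :: nat
  reg :: "nat \<Rightarrow> nat"
  mem :: "nat \<Rightarrow> nat"
  emitted :: "nat list"

fun ram_arith :: "ram_op \<Rightarrow> nat \<Rightarrow> nat \<Rightarrow> nat" where
  "ram_arith Add x y = x + y"
| "ram_arith Sub x y = x - y"
| "ram_arith Mul x y = x * y"
| "ram_arith Quo x y = x div y"
| "ram_arith Rem x y = x mod y"

fun ram_exec :: "nat \<Rightarrow> ram_instr \<Rightarrow> ram_state \<Rightarrow> ram_state" where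
  "ram_exec w (Const r k) s = s\<lparr>pc := pc s + 1, reg := (reg s)(r := k mod 2 ^ w)\<rparr>"
| "ram_exec w (Arith f r a b) s =
     s\<lparr>pc := pc s + 1, reg := (reg s)(r := ram_arith f (reg s a) (reg s b) mod 2 ^ w)\<rparr>"
| "ram_exec w (Load r a) s = s\<lparr>pc := pc s + 1, reg := (reg s)(r := mem s (reg s a))\<rparr>"
| "ram_exec w (Store a r) s = s\<lparr>pc := pc s + 1, mem := (mem s)(reg s a := reg s r)\<rparr>"
| "ram_exec w (Jump l) s = s\<lparr>pc := l\<rparr>"
| "ram_exec w (JumpZero r l) s = s\<lparr>pc := (if reg s r = 0 then l else pc s + 1)\<rparr>"
| "ram_exec w (Emit r) s = s\<lparr>pc := pc s + 1, emitted := emitted s @ [reg s r]\<rparr>"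

definition ram_step :: "nat \<Rightarrow> ram_instr list \<Rightarrow> ram_state \<Rightarrow> ram_state" where
  "ram_step w P s = (if pc s < length P then ram_exec w (P ! pc s) s else s)"

definition ram_init :: "nat list \<Rightarrow> ram_state" where
  "ram_init xs =
     \<lparr>pc = 0, reg = (\<lambda>_. 0), mem = (\<lambda>a. if a < length xs then xs ! a else 0), emitted = []\<rparr>"

definition ram_computes ::
    "nat \<Rightarrow> ram_instr list \<Rightarrow> nat list \<Rightarrow> nat \<Rightarrow> nat list \<Rightarrow> bool" where
  "ram_computes w P xs T ys \<longleftrightarrow>
     (\<exists>t\<le>T. length P \<le> pc ((ram_step w P ^^ t) (ram_init xs)) \<and>
             emitted ((ram_step w P ^^ t) (ram_init xs)) = ys)"

text \<open>
  The usual assumption that the word length is within a constant factor of what is needed to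
  address the input and to store each of its entries in one cell.
\<close>

definition word_length :: "nat \<Rightarrow> nat list \<Rightarrow> nat" where
  "word_length c xs = c * nat \<lceil>log 2 (real (length xs + Max (set xs) + 2))\<rceil>"

definition adjacency_words :: "nat \<Rightarrow> (nat \<times> nat) set \<Rightarrow> nat list" where
  "adjacency_words n A = concat (map (\<lambda>u. map (\<lambda>v. of_bool ((u, v) \<in> A)) [0..<n]) [0..<n])"

text \<open>
  The memory contents when a query starts: the parameters, the failed edges, and the graph and
  the subgraphs of the family as adjacency matrices. No other precomputed data is available; an
  arbitrary precomputed memory would admit a table of the answers for all \<open>F\<close>.
\<close>

definition query_input ::
    "wgraph \<Rightarrow> nat \<Rightarrow> nat \<Rightarrow> nat \<Rightarrow> (nat \<Rightarrow> (nat \<times> nat) set) \<Rightarrow> (nat \<times> nat) list \<Rightarrow> nat list" where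
  "query_input G L f K H Fs =
     [nverts G, of_bool (directed G), L, f, K, length Fs] @
     concat (map (\<lambda>(u, v). [u, v]) Fs) @
     adjacency_words (nverts G) (edges G) @
     concat (map (\<lambda>i. adjacency_words (nverts G) (H i)) [0..<K])"

text \<open>
  Coverings for all graphs, with parameters depending on the number \<open>n\<close> of vertices: covering
  value at most \<open>cv n\<close>, subfamilies of size at most \<open>sz n\<close>, and a single program that, given any
  listing \<open>Fs\<close> of a failure set \<open>F\<close>, lists the indices in \<open>S F\<close> within \<open>qt n\<close> steps.
\<close>

definition has_coverings ::
    "(nat \<Rightarrow> nat) \<Rightarrow> (nat \<Rightarrow> nat) \<Rightarrow> (nat \<Rightarrow> real) \<Rightarrow> (nat \<Rightarrow> real) \<Rightarrow> (nat \<Rightarrow> real) \<Rightarrow> bool" where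
  "has_coverings L f cv qt sz \<longleftrightarrow>
     (\<exists>P c. \<forall>n G. wf_wgraph G \<and> nverts G = n \<longrightarrow>
       (\<exists>K H S.
          replacement_path_covering G (L n) (f n) K H S \<and>
          real K \<le> cv n \<and>
          (\<forall>F. F \<subseteq> edges G \<and> card F \<le> f n \<longrightarrow> real (card (S F)) \<le> sz n) \<and>
          (\<forall>Fs. distinct Fs \<and> set Fs \<subseteq> edges G \<and> length Fs \<le> f n \<longrightarrow>
             (\<exists>T ys. real T \<le> qt n \<and> distinct ys \<and> set ys = S (set Fs) \<and>
                (let xs = query_input G (L n) (f n) K H Fs
                 in ram_computes (word_length c xs) P xs T ys)))))"

section \<open>Asymptotics\<close>

definition soft_O :: "(nat \<Rightarrow> real) \<Rightarrow> (nat \<Rightarrow> real) set" where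
  "soft_O g = (\<Union>k. O(\<lambda>n. g n * ln (real n) ^ k))"

end

theory Submission
  imports Defs
begin

text \<open>
  Colour the edges at random with \<open>q\<close> colours, where \<open>q\<close> is the least power of two that is at least
  \<open>2 * min L n\<close>, and delete, for every choice of at most \<open>f\<close> colours, all edges of these colours.
  For a failure set \<open>F\<close> the graph that misses exactly the colours of \<open>F\<close> avoids \<open>F\<close>, and it
  retains a given path with at most \<open>L\<close> edges with probability at least \<open>1 / 4 ^ f\<close>: if
  \<open>f < min L n\<close> because \<open>(1 - f / q) ^ min L n\<close> is that large, and otherwise because with this
  probability \<open>F\<close> receives only colours below \<open>q / 2\<close> and the path only the remaining ones.
  Repeated averaging yields \<open>R = 4 ^ f * O(f * log n)\<close> fixed colourings such that each \<open>F\<close>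
  and each pair of vertices is served by one of them. The covering value is then
  \<open>R * (O(L)) ^ f\<close>, the subfamily of \<open>F\<close> has one member per colouring, and \<open>C ^ f\<close> is
  \<open>L ^ o(1)\<close> or \<open>n ^ o(1)\<close> by the assumption on \<open>f\<close>.

  A query has to recover the colours of \<open>F\<close> from the family itself. To this end each colouring
  contributes one further graph per bit position, containing the edges whose colour has this bit set.
\<close>

section \<open>Structured programs on the word RAM\<close>

datatype com = Block "ram_instr list" | Seq com com (infixr ";;" 60) | While nat com | When nat com

fun csize :: "com \<Rightarrow> nat" where
  "csize (Block is) = length is"
| "csize (a ;; b) = csize a + csize b"
| "csize (While x c) = csize c + 2"
| "csize (When x c) = csize c + 1"

text \<open>Jump targets are absolute, so the position \<open>l\<close> of the first instruction is
  a parameter.\<close>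

fun compile :: "nat \<Rightarrow> com \<Rightarrow> ram_instr list" where
  "compile l (Block is) = is"
| "compile l (a ;; b) = compile l a @ compile (l + csize a) b"
| "compile l (While x c) = JumpZero x (l + csize c + 2) # compile (l + 1) c @ [Jump l]"
| "compile l (When x c) = JumpZero x (l + csize c + 1) # compile (l + 1) c"

fun straight :: "ram_instr \<Rightarrow> bool" where
  "straight (Jump l) = False"
| "straight (JumpZero x l) = False"
| "straight _ = True"

lemma length_compile [simp]: "length (compile l c) = csize c"
  by (induction c arbitrary: l) auto

text \<open>Quantifying over the surrounding code makes executions composable: the program counters
  of \<open>s\<close> and \<open>s'\<close> are overwritten, so that runs can be chained at any
  position.\<close>

definition runs :: "nat \<Rightarrow> com \<Rightarrow> nat \<Rightarrow> ram_state \<Rightarrow> ram_state \<Rightarrow> bool" where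
  "runs w c T s s' \<longleftrightarrow>
     (\<forall>pre post. \<exists>t\<le>T.
        (ram_step w (pre @ compile (length pre) c @ post) ^^ t) (s\<lparr>pc := length pre\<rparr>) =
          s'\<lparr>pc := length pre + csize c\<rparr>)"

lemma runsE:
  assumes "runs w c T s s'" "Q = pre @ compile l c @ post" "l = length pre"
  obtains t where "t \<le> T" "(ram_step w Q ^^ t) (s\<lparr>pc := l\<rparr>) = s'\<lparr>pc := l + csize c\<rparr>"
  using assms unfolding runs_def by blast

lemma runs_Block:
  assumes "list_all straight is"
  shows "runs w (Block is) (length is) s (fold (ram_exec w) is s)"
proof -
  have "(ram_step w (pre @ is @ post) ^^ length is) (s\<lparr>pc := length pre\<rparr>) =
      (fold (ram_exec w) is s)\<lparr>pc := length pre + length is\<rparr>" for pre post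
    using assms
  proof (induction "is" arbitrary: pre s)
    case (Cons i js)
    have "ram_step w (pre @ (i # js) @ post) (s\<lparr>pc := length pre\<rparr>) =
        (ram_exec w i s)\<lparr>pc := length (pre @ [i])\<rparr>"
      using Cons.prems by (cases i) (auto simp: ram_step_def)
    then show ?case
      using Cons.IH[of "pre @ [i]" "ram_exec w i s"] Cons.prems
      by (simp add: funpow_Suc_right del: funpow.simps)
  qed simp
  then show ?thesis unfolding runs_def by auto
qed

lemma runs_Seq:
  assumes "runs w a T s s'" "runs w b U s' s''"
  shows "runs w (a ;; b) (T + U) s s''"
  unfolding runs_def
proof (intro allI)
  fix pre post :: "ram_instr list"
  let ?l = "length pre"
  let ?P = "pre @ compile ?l (a ;; b) @ post"
  have P1: "?P = pre @ compile ?l a @ (compile (?l + csize a) b @ post)"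
    and P2: "?P = (pre @ compile ?l a) @ compile (?l + csize a) b @ post"
    by simp_all
  obtain t where t: "t \<le> T" "(ram_step w ?P ^^ t) (s\<lparr>pc := ?l\<rparr>) = s'\<lparr>pc := ?l + csize a\<rparr>"
    by (rule runsE[OF assms(1) P1 refl])
  obtain u where u: "u \<le> U" "(ram_step w ?P ^^ u) (s'\<lparr>pc := ?l + csize a\<rparr>)
      = s''\<lparr>pc := ?l + csize a + csize b\<rparr>"
    by (rule runsE[OF assms(2) P2]) simp
  show "\<exists>t\<le>T + U. (ram_step w ?P ^^ t) (s\<lparr>pc := ?l\<rparr>) = s''\<lparr>pc := ?l + csize (a ;; b)\<rparr>"
    using t u by (intro exI[of _ "u + t"]) (simp add: funpow_add add.assoc)
qed

lemma runs_While_exit: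
  assumes "reg s x = 0"
  shows "runs w (While x c) 1 s s"
  unfolding runs_def using assms
  by (intro allI exI[of _ "1::nat"]) (simp add: ram_step_def)

lemma runs_While_iter:
  assumes "reg s x \<noteq> 0" "runs w c T s s'" "runs w (While x c) U s' s''"
  shows "runs w (While x c) (T + 2 + U) s s''"
  unfolding runs_def
proof (intro allI)
  fix pre post :: "ram_instr list"
  let ?l = "length pre"
  let ?P = "pre @ compile ?l (While x c) @ post"
  let ?step = "ram_step w ?P"
  have P1: "?P = (pre @ [JumpZero x (?l + csize c + 2)]) @ compile (?l + 1) c @ (Jump ?l # post)"
    by simp
  obtain t where t: "t \<le> T" "(?step ^^ t) (s\<lparr>pc := ?l + 1\<rparr>) = s'\<lparr>pc := ?l + 1 + csize c\<rparr>"
    by (rule runsE[OF assms(2) P1]) simp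
  obtain u where u: "u \<le> U" "(?step ^^ u) (s'\<lparr>pc := ?l\<rparr>) = s''\<lparr>pc := ?l + csize (While x c)\<rparr>"
    by (rule runsE[OF assms(3) refl refl])
  have enter: "?step (s\<lparr>pc := ?l\<rparr>) = s\<lparr>pc := ?l + 1\<rparr>"
    using assms(1) by (simp add: ram_step_def)
  have "?P ! (?l + 1 + csize c) = Jump ?l"
    by (simp add: nth_append)
  then have loop: "?step (s'\<lparr>pc := ?l + 1 + csize c\<rparr>) = s'\<lparr>pc := ?l\<rparr>"
    by (simp add: ram_step_def)
  have "(?step ^^ (u + (1 + (t + 1)))) (s\<lparr>pc := ?l\<rparr>) = s''\<lparr>pc := ?l + csize (While x c)\<rparr>"
    using enter t loop u unfolding funpow_add by simp
  then show "\<exists>t\<le>T + 2 + U. (?step ^^ t) (s\<lparr>pc := ?l\<rparr>) = s''\<lparr>pc := ?l + csize (While x c)\<rparr>"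
    using t u by (intro exI[of _ "u + (1 + (t + 1))"]) simp
qed

lemma runs_When_skip:
  assumes "reg s x = 0"
  shows "runs w (When x c) 1 s s"
  unfolding runs_def using assms
  by (intro allI exI[of _ "1::nat"]) (simp add: ram_step_def)

lemma runs_When_enter:
  assumes "reg s x \<noteq> 0" "runs w c T s s'"
  shows "runs w (When x c) (T + 1) s s'"
  unfolding runs_def
proof (intro allI)
  fix pre post :: "ram_instr list"
  let ?l = "length pre"
  let ?P = "pre @ compile ?l (When x c) @ post"
  have P1: "?P = (pre @ [JumpZero x (?l + csize c + 1)]) @ compile (?l + 1) c @ post"
    by simp
  obtain t where t: "t \<le> T" "(ram_step w ?P ^^ t) (s\<lparr>pc := ?l + 1\<rparr>) = s'\<lparr>pc := ?l + 1 + csize c\<rparr>"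
    by (rule runsE[OF assms(2) P1]) simp
  have enter: "ram_step w ?P (s\<lparr>pc := ?l\<rparr>) = s\<lparr>pc := ?l + 1\<rparr>"
    using assms(1) by (simp add: ram_step_def)
  show "\<exists>t\<le>T + 1. (ram_step w ?P ^^ t) (s\<lparr>pc := ?l\<rparr>) = s'\<lparr>pc := ?l + csize (When x c)\<rparr>"
    using t enter by (intro exI[of _ "Suc t"]) (simp add: funpow_Suc_right del: funpow.simps)
qed

section \<open>Hoare triples with step bounds\<close>

definition triple :: "nat \<Rightarrow> (ram_state \<Rightarrow> bool) \<Rightarrow> com \<Rightarrow> nat \<Rightarrow> (ram_state \<Rightarrow> bool) \<Rightarrow> bool" where
  "triple w P c T Q \<longleftrightarrow> (\<forall>s. P s \<longrightarrow> (\<exists>s'. runs w c T s s' \<and> Q s'))"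

lemma triple_Seq:
  "triple w P a T Q \<Longrightarrow> triple w Q b U R \<Longrightarrow> triple w P (a ;; b) (T + U) R"
  unfolding triple_def by (meson runs_Seq)

lemma triple_Block:
  assumes "\<And>s. P s \<Longrightarrow> Q (fold (ram_exec w) is s)" "list_all straight is"
    and "T = length is"
  shows "triple w P (Block is) T Q"
  unfolding triple_def using assms runs_Block by blast

text \<open>The index of the invariant is the number of iterations left. Each iteration pays 2 extra
  steps, for the test and the jump back; the last test costs 1.\<close>

lemma triple_While:
  assumes body: "\<And>k. k < m \<Longrightarrow> triple w (I (Suc k)) c T (I k)"
    and guard: "\<And>k s. k \<le> m \<Longrightarrow> I k s \<Longrightarrow> reg s x = 0 \<longleftrightarrow> k = 0"
  shows "triple w (I m) (While x c) (m * (T + 2) + 1) (I 0)"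
proof -
  have "\<exists>s'. runs w (While x c) (k * (T + 2) + 1) s s' \<and> I 0 s'" if "k \<le> m" "I k s" for k s
    using that
  proof (induction k arbitrary: s)
    case 0
    then show ?case using runs_While_exit[of s x w c] guard[of 0 s] by auto
  next
    case (Suc k)
    then obtain s' where s': "runs w c T s s'" "I k s'"
      using body[of k] unfolding triple_def by fastforce
    with Suc obtain s'' where "runs w (While x c) (k * (T + 2) + 1) s' s''" "I 0 s''"
      by fastforce
    moreover have "reg s x \<noteq> 0"
      using guard Suc.prems by blast
    ultimately have "runs w (While x c) (T + 2 + (k * (T + 2) + 1)) s s''"
      using runs_While_iter s' by blast
    then show ?case using \<open>I 0 s''\<close> by (auto simp: algebra_simps)
  qed
  then show ?thesis unfolding triple_def by blast
qed

lemma triple_When: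
  assumes "triple w (\<lambda>s. P s \<and> reg s x \<noteq> 0) c T Q" "\<And>s. P s \<Longrightarrow> reg s x = 0 \<Longrightarrow> Q s"
  shows "triple w P (When x c) (T + 1) Q"
  unfolding triple_def
proof (intro allI impI)
  fix s assume "P s"
  show "\<exists>s'. runs w (When x c) (T + 1) s s' \<and> Q s'"
  proof (cases "reg s x = 0")
    case True
    have "runs w (When x c) (T + 1) s s"
      using runs_When_skip[OF True, of w c] unfolding runs_def
      by (meson le_add2 order_trans)
    then show ?thesis using assms(2) \<open>P s\<close> True by blast
  next
    case False
    then show ?thesis using assms(1) \<open>P s\<close> runs_When_enter unfolding triple_def by meson
  qed
qed

lemma triple_ram_computes:
  assumes "triple w ((=) (ram_init xs)) c T (\<lambda>s. emitted s = ys)"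
  shows "ram_computes w (compile 0 c) xs T ys"
proof -
  obtain s' where s': "runs w c T (ram_init xs) s'" "emitted s' = ys"
    using assms unfolding triple_def by blast
  obtain t where "t \<le> T" "(ram_step w (compile 0 c) ^^ t) ((ram_init xs)\<lparr>pc := 0\<rparr>) = s'\<lparr>pc := 0 + csize c\<rparr>"
    by (rule runsE[OF s'(1), of "compile 0 c" "[]" 0 "[]"]) auto
  moreover have "(ram_init xs)\<lparr>pc := 0\<rparr> = ram_init xs"
    by (simp add: ram_init_def)
  ultimately show ?thesis
    unfolding ram_computes_def using s'(2) by (intro exI[of _ t]) simp
qed

section \<open>The query program\<close>

abbreviation (input) "rOne \<equiv> 0::nat"
abbreviation (input) "rN \<equiv> 1::nat"
abbreviation (input) "rTwoL \<equiv> 2::nat"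
abbreviation (input) "rFails \<equiv> 3::nat"
abbreviation (input) "rTwoN \<equiv> 4::nat"
abbreviation (input) "rSix \<equiv> 5::nat"
abbreviation (input) "rSquare \<equiv> 6::nat"
abbreviation (input) "rBase \<equiv> 7::nat"
abbreviation (input) "rBits \<equiv> 8::nat"
abbreviation (input) "rQ \<equiv> 9::nat"
abbreviation (input) "rTuples \<equiv> 10::nat"
abbreviation (input) "rBlock \<equiv> 11::nat"
abbreviation (input) "rOuter \<equiv> 12::nat"
abbreviation (input) "rFirst \<equiv> 13::nat"
abbreviation (input) "rI \<equiv> 14::nat"
abbreviation (input) "rJ \<equiv> 15::nat"
abbreviation (input) "rOffset \<equiv> 16::nat"
abbreviation (input) "rKey \<equiv> 17::nat"
abbreviation (input) "rPow \<equiv> 18::nat"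
abbreviation (input) "rCol \<equiv> 19::nat"
abbreviation (input) "rA \<equiv> 20::nat"
abbreviation (input) "rB \<equiv> 21::nat"

text \<open>Cells 0 and 2 to 5 of \<open>query_input\<close> hold \<open>n\<close>,
  \<open>L\<close>, \<open>f\<close>, the family size and the number of failures.
  \<open>rBase\<close> becomes the address of the first matrix of the family. \<open>rI\<close>
  receives \<open>f\<close> for the loop around \<open>prog_power\<close>, \<open>rOuter\<close> the
  family size until \<open>prog_blocks\<close> divides it.\<close>

definition prog_init :: "ram_instr list" where
  "prog_init =
    [Const rOne 1, Const rA 0, Load rN rA, Const rA 2, Load rTwoL rA, Arith Add rTwoL rTwoL rTwoL,
     Const rA 3, Load rI rA, Const rA 4, Load rOuter rA, Const rA 5, Load rFails rA,
     Arith Add rTwoN rN rN, Const rSix 6, Arith Mul rSquare rN rN,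
     Arith Add rBase rFails rFails, Arith Add rBase rBase rSix, Arith Add rBase rBase rSquare,
     Const rBits 0, Const rQ 1, Const rTuples 1, Const rFirst 0,
     Arith Sub rA rTwoL rQ, Arith Sub rB rTwoN rQ, Arith Mul rA rA rB]"

text \<open>
  As subtraction is truncated, the product of \<open>2 L - q\<close> and \<open>2 n - q\<close> vanishes iff
  \<open>2 * min L n \<le> q\<close>.
\<close>

definition prog_double :: "ram_instr list" where
  "prog_double =
    [Arith Add rQ rQ rQ, Arith Add rBits rBits rOne,
     Arith Sub rA rTwoL rQ, Arith Sub rB rTwoN rQ, Arith Mul rA rA rB]"

definition prog_power :: "ram_instr list" where
  "prog_power = [Arith Mul rTuples rTuples rQ, Arith Sub rI rI rOne]"

text \<open>The number of colourings is not in the input; it is the family size divided by the block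
  size.\<close>

definition prog_blocks :: "ram_instr list" where
  "prog_blocks = [Arith Add rBlock rTuples rBits, Arith Quo rOuter rOuter rBlock]"

definition prog_load_edge :: "ram_instr list" where
  "prog_load_edge =
    [Arith Sub rI rI rOne, Arith Add rA rI rI, Arith Add rA rA rSix, Load rKey rA,
     Arith Mul rKey rKey rN, Arith Add rA rA rOne, Load rB rA, Arith Add rKey rKey rB,
     Const rPow 1, Arith Mul rJ rFails rOne]"

text \<open>\<open>rA\<close> ends as the truncated difference of two keys, nonzero iff the edge at
  position \<open>rJ\<close> has the smaller key. Each such edge raises the rank by one, so
  \<open>prog_edge\<close> then multiplies \<open>rPow\<close> by \<open>q\<close>.\<close>

definition prog_compare :: "ram_instr list" where
  "prog_compare =
    [Arith Sub rJ rJ rOne, Arith Add rA rJ rJ, Arith Add rA rA rSix, Load rB rA,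
     Arith Mul rB rB rN, Arith Add rA rA rOne, Load rA rA, Arith Add rB rB rA, Arith Sub rA rKey rB]"

text \<open>Horner scheme: the bits of the colour are read from the highest down out of the bit
  graphs of the current block.\<close>

definition prog_bit :: "ram_instr list" where
  "prog_bit =
    [Arith Sub rJ rJ rOne, Arith Add rA rFirst rTuples, Arith Add rA rA rJ, Arith Mul rA rA rSquare,
     Arith Add rA rA rBase, Arith Add rA rA rKey, Load rA rA,
     Arith Add rCol rCol rCol, Arith Add rCol rCol rA]"

definition prog_edge :: com where
  "prog_edge =
    Block prog_load_edge ;;
    While rJ (Block prog_compare ;; When rA (Block [Arith Mul rPow rPow rQ])) ;;
    Block [Const rCol 0, Arith Mul rJ rBits rOne] ;;
    While rJ (Block prog_bit) ;;
    Block [Arith Mul rCol rCol rPow, Arith Add rOffset rOffset rCol]"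

definition query_prog :: com where
  "query_prog =
    Block prog_init ;;
    While rA (Block prog_double) ;;
    While rI (Block prog_power) ;;
    Block prog_blocks ;;
    While rOuter
     (Block [Const rOffset 0, Arith Mul rI rFails rOne] ;;
      While rI prog_edge ;;
      Block [Arith Add rA rFirst rOffset, Emit rA, Arith Add rFirst rFirst rBlock,
             Arith Sub rOuter rOuter rOne])"

text \<open>Capping \<open>L\<close> at \<open>n\<close> is possible because a path has at most
  \<open>n\<close> edges; it makes the number of bits logarithmic in \<open>n\<close> however large
  \<open>L\<close> is.\<close>

definition colour_bits :: "nat \<Rightarrow> nat \<Rightarrow> nat" where
  "colour_bits L n = (LEAST b. 2 * min L n \<le> 2 ^ b)"

lemma colour_bits_ge: "2 * min L n \<le> 2 ^ colour_bits L n"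
  unfolding colour_bits_def by (rule LeastI[of _ "2 * min L n"]) (simp add: less_imp_le)

lemma colour_bits_less: "b < colour_bits L n \<Longrightarrow> 2 ^ b < 2 * min L n"
  unfolding colour_bits_def using not_less_Least by (metis not_le)

section \<open>Correctness and step count of the query program\<close>

text \<open>The memory is described abstractly: \<open>key i\<close> and \<open>col r i\<close> are
  the key of the \<open>i\<close>-th failed edge and its colour under colouring \<open>r\<close>,
  and \<open>M\<close> is the number of graphs per colouring. \<open>X\<close> bounds the addresses
  and parameters; \<open>4 * X * X < 2 ^ w\<close> keeps even the guard product of
  \<open>prog_double\<close> from overflowing.\<close>

locale colour_query =
  fixes w n L f k R X :: nat and m :: "nat \<Rightarrow> nat" and key :: "nat \<Rightarrow> nat"
    and col :: "nat \<Rightarrow> nat \<Rightarrow> nat"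
  fixes B M :: nat and offset :: "nat \<Rightarrow> nat"
  defines "B \<equiv> colour_bits L n" and "M \<equiv> (2 ^ B) ^ f + B"
    and "offset \<equiv> \<lambda>r. \<Sum>i<k. col r i * (2 ^ B) ^ card {j. j < k \<and> key j < key i}"
  assumes X: "6 + 2 * k + n * n + (R * M) * (n * n) < X" "L < X" "f < X" "n < X" "R * M < X" "4 * X * X < 2 ^ w"
    and f: "1 \<le> f" "k \<le> f" and R: "1 \<le> R"
    and mem_params: "m 0 = n" "m 2 = L" "m 3 = f" "m 4 = R * M" "m 5 = k"
    and mem_edges: "\<And>i. i < k \<Longrightarrow> m (6 + 2 * i) * n + m (7 + 2 * i) = key i"
    and key: "\<And>i. i < k \<Longrightarrow> key i < n * n"
    and mem_bits: "\<And>r j i. r < R \<Longrightarrow> j < B \<Longrightarrow> i < k \<Longrightarrow>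
        m (6 + 2 * k + n * n + (r * M + (2 ^ B) ^ f + j) * (n * n) + key i) = col r i div 2 ^ j mod 2"
    and col: "\<And>r i. r < R \<Longrightarrow> i < k \<Longrightarrow> col r i < 2 ^ B"
    and offset_less: "\<And>r. r < R \<Longrightarrow> offset r < (2 ^ B) ^ f"
begin

abbreviation "Q \<equiv> ((2::nat) ^ B) ^ f"

definition env :: "ram_state \<Rightarrow> bool" where
  "env s \<longleftrightarrow> mem s = m \<and> reg s rOne = 1 \<and> reg s rN = n \<and> reg s rTwoL = 2 * L \<and> reg s rFails = k \<and>
     reg s rTwoN = 2 * n \<and> reg s rSix = 6 \<and> reg s rSquare = n * n \<and>
     reg s rBase = 6 + 2 * k + n * n"

definition env' :: "ram_state \<Rightarrow> bool" where
  "env' s \<longleftrightarrow> env s \<and> reg s rBits = B \<and> reg s rQ = 2 ^ B \<and> reg s rTuples = Q \<and> reg s rBlock = M"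

lemma X_less: "c \<le> 2 * X \<Longrightarrow> c < 2 ^ w"
proof -
  assume c: "c \<le> 2 * X"
  have "2 * X * 1 \<le> 2 * X * (2 * X)" using X by (intro mult_left_mono) auto
  then show ?thesis using c X by (simp add: algebra_simps)
qed

lemma mod_small: "c \<le> 2 * X \<Longrightarrow> c mod 2 ^ w = c"
  using X_less by simp

lemma w_pos: "0 < w"
  using X by (cases w) auto

lemma Q_less: "Q < X"
proof -
  have "Q \<le> 1 * M" by (simp add: M_def)
  also have "\<dots> \<le> R * M" using R by (intro mult_right_mono) auto
  finally show ?thesis using X by simp
qed

lemma q_le_Q: "2 ^ B \<le> Q"
  using f by (metis power_increasing power_one_right one_le_numeral one_le_power)

lemma M_less: "M < X"
  using X R by (metis M_def le_less_trans mult_le_mono1 mult_1)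

text \<open>Here and in the following loop invariants the index counts the iterations left, as
  \<open>triple_While\<close> requires.\<close>

definition I_double :: "nat \<Rightarrow> ram_state \<Rightarrow> bool" where
  "I_double t s \<longleftrightarrow> t \<le> B \<and> env s \<and> reg s rI = f \<and> reg s rOuter = R * M \<and> reg s rFirst = 0 \<and>
     reg s rTuples = 1 \<and> emitted s = [] \<and> reg s rBits = B - t \<and> reg s rQ = 2 ^ (B - t) \<and>
     reg s rA = (2 * L - 2 ^ (B - t)) * (2 * n - 2 ^ (B - t))"

definition I_power :: "nat \<Rightarrow> ram_state \<Rightarrow> bool" where
  "I_power t s \<longleftrightarrow> t \<le> f \<and> env s \<and> reg s rOuter = R * M \<and> reg s rFirst = 0 \<and> emitted s = [] \<and>
     reg s rBits = B \<and> reg s rQ = 2 ^ B \<and> reg s rI = t \<and> reg s rTuples = (2 ^ B) ^ (f - t)"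

definition I_outer :: "nat \<Rightarrow> ram_state \<Rightarrow> bool" where
  "I_outer t s \<longleftrightarrow> t \<le> R \<and> env' s \<and> reg s rOuter = t \<and> reg s rFirst = (R - t) * M \<and>
     emitted s = map (\<lambda>r. r * M + offset r) [0..<R - t]"

text \<open>Edges are handled from the last to the first, so the terms with index at least
  \<open>t\<close> have already been added.\<close>

definition I_edge :: "nat \<Rightarrow> nat \<Rightarrow> ram_state \<Rightarrow> bool" where
  "I_edge r t s \<longleftrightarrow> t \<le> k \<and> env' s \<and> reg s rOuter = R - r \<and> reg s rFirst = r * M \<and>
     emitted s = map (\<lambda>r. r * M + offset r) [0..<r] \<and> reg s rI = t \<and>
     reg s rOffset = (\<Sum>i\<in>{t..<k}. col r i * (2 ^ B) ^ card {j. j < k \<and> key j < key i})"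

definition edge_env :: "nat \<Rightarrow> nat \<Rightarrow> ram_state \<Rightarrow> bool" where
  "edge_env r i s \<longleftrightarrow> env' s \<and> reg s rOuter = R - r \<and> reg s rFirst = r * M \<and>
     emitted s = map (\<lambda>r. r * M + offset r) [0..<r] \<and> reg s rI = i \<and>
     reg s rOffset = (\<Sum>i\<in>{Suc i..<k}. col r i * (2 ^ B) ^ card {j. j < k \<and> key j < key i}) \<and>
     reg s rKey = key i"

definition I_rank :: "nat \<Rightarrow> nat \<Rightarrow> nat \<Rightarrow> ram_state \<Rightarrow> bool" where
  "I_rank r i t s \<longleftrightarrow> t \<le> k \<and> edge_env r i s \<and> reg s rJ = t \<and>
     reg s rPow = (2 ^ B) ^ card {j. t \<le> j \<and> j < k \<and> key j < key i}"

definition I_bit :: "nat \<Rightarrow> nat \<Rightarrow> nat \<Rightarrow> ram_state \<Rightarrow> bool" where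
  "I_bit r i t s \<longleftrightarrow> t \<le> B \<and> edge_env r i s \<and> reg s rJ = t \<and>
     reg s rPow = (2 ^ B) ^ card {j. j < k \<and> key j < key i} \<and> reg s rCol = col r i div 2 ^ t"

lemma cond_less: "(2 * L - a) * (2 * n - b) < 2 ^ w"
proof -
  have "(2 * L - a) * (2 * n - b) \<le> (2 * X) * (2 * X)"
    using X by (intro mult_mono) auto
  then show ?thesis using X by simp
qed

lemmas mod_collapse = mod_add_left_eq mod_add_right_eq mod_mult_left_eq mod_mult_right_eq

lemma triple_init:
  assumes "mem s0 = m" "emitted s0 = []"
  shows "triple w ((=) s0) (Block prog_init) 25 (I_double B)"
proof -
  have X6: "6 < X" using X by simp
  have sm: "6 mod 2 ^ w = (6::nat)" "5 mod 2 ^ w = (5::nat)" "4 mod 2 ^ w = (4::nat)"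
    "3 mod 2 ^ w = (3::nat)" "2 mod 2 ^ w = (2::nat)" "1 mod 2 ^ w = (1::nat)" "Suc 0 mod 2 ^ w = (Suc 0::nat)"
    "(L + L) mod 2 ^ w = 2 * L" "(n + n) mod 2 ^ w = 2 * n" "n * n mod 2 ^ w = n * n"
    "(k + k) mod 2 ^ w = 2 * k" "(2 * k + 6) mod 2 ^ w = 6 + 2 * k"
    "(6 + 2 * k + n * n) mod 2 ^ w = 6 + 2 * k + n * n"
    "(2 * L - Suc 0) mod 2 ^ w = 2 * L - Suc 0" "(2 * n - Suc 0) mod 2 ^ w = 2 * n - Suc 0"
    "((2 * L - Suc 0) * (2 * n - Suc 0)) mod 2 ^ w = (2 * L - Suc 0) * (2 * n - Suc 0)"
    using X X6 mod_small cond_less w_pos by auto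
  show "triple w ((=) s0) (Block prog_init) 25 (I_double B)"
    by (rule triple_Block)
      (auto simp: prog_init_def I_double_def env_def assms mem_params sm w_pos)
qed

lemma triple_double: "triple w (I_double B) (While rA (Block prog_double)) (B * 7 + 1) (I_double 0)"
proof -
  have "triple w (I_double (Suc t)) (Block prog_double) 5 (I_double t)" if "t < B" for t
  proof -
    have d: "(2::nat) ^ (B - Suc t) + 2 ^ (B - Suc t) = 2 ^ (B - t)"
      using that by (metis Suc_diff_Suc mult_2 power_Suc)
    have le: "(2::nat) ^ (B - t) \<le> 2 ^ B" by (simp add: power_increasing)
    have sm: "(2::nat) ^ (B - t) mod 2 ^ w = 2 ^ (B - t)" using le q_le_Q Q_less by (intro mod_small) linarith
    have "B < 2 ^ B" by simp
    then have sb: "(B - t) mod 2 ^ w = B - t" using q_le_Q Q_less by (intro mod_small) linarith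
    have sc: "(2 * L - 2 ^ (B - t)) mod 2 ^ w = 2 * L - 2 ^ (B - t)"
      "(2 * n - 2 ^ (B - t)) mod 2 ^ w = 2 * n - 2 ^ (B - t)"
      using X_less[of "2 * L - 2 ^ (B - t)"] X_less[of "2 * n - 2 ^ (B - t)"] X by auto
    show "triple w (I_double (Suc t)) (Block prog_double) 5 (I_double t)"
      using that
      by (intro triple_Block)
        (auto simp: prog_double_def I_double_def env_def d sm sb sc cond_less Suc_diff_Suc)
  qed
  moreover have "reg s rA = 0 \<longleftrightarrow> t = 0" if "t \<le> B" "I_double t s" for t s
  proof -
    have "reg s rA = 0 \<longleftrightarrow> 2 * min L n \<le> 2 ^ (B - t)"
      using that by (auto simp: I_double_def min_def)
    \<comment> \<open>By minimality of \<open>colour_bits\<close> no smaller power of two passes the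
      test, so the loop makes exactly \<open>B\<close> rounds.\<close>
    also have "\<dots> \<longleftrightarrow> t = 0"
      using colour_bits_ge[of L n] colour_bits_less[of "B - t" L n] that
      unfolding B_def[symmetric] by (cases "t = 0") (auto simp: not_le)
    finally show ?thesis .
  qed
  ultimately have "triple w (I_double B) (While rA (Block prog_double)) (B * (5 + 2) + 1) (I_double 0)"
    by (intro triple_While)
  then show ?thesis by simp
qed

lemma triple_power: "triple w (I_double 0) (While rI (Block prog_power)) (f * 4 + 1) (I_power 0)"
proof -
  have "triple w (I_power (Suc t)) (Block prog_power) 2 (I_power t)" if "t < f" for t
  proof -
    have d: "((2::nat) ^ B) ^ (f - Suc t) * 2 ^ B = (2 ^ B) ^ (f - t)"
      using that by (metis Suc_diff_Suc mult.commute power_Suc)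
    have "((2::nat) ^ B) ^ (f - t) \<le> Q" by (simp add: power_increasing)
    then have sm: "((2::nat) ^ B) ^ (f - t) mod 2 ^ w = (2 ^ B) ^ (f - t)"
      using Q_less X_less by simp
    have st: "t mod 2 ^ w = t" using X X_less[of t] that by simp
    show "triple w (I_power (Suc t)) (Block prog_power) 2 (I_power t)"
      using that
      by (intro triple_Block) (auto simp: prog_power_def I_power_def env_def d sm st)
  qed
  moreover have "reg s rI = 0 \<longleftrightarrow> t = 0" if "t \<le> f" "I_power t s" for t s
    using that by (simp add: I_power_def)
  ultimately have "triple w (I_power f) (While rI (Block prog_power)) (f * (2 + 2) + 1) (I_power 0)"
    by (intro triple_While)
  moreover have "I_double 0 s \<Longrightarrow> I_power f s" for s
    by (simp add: I_double_def I_power_def)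
  ultimately show ?thesis by (simp add: triple_def)
qed

lemma triple_blocks: "triple w (I_power 0) (Block prog_blocks) 2 (I_outer R)"
proof -
  have [simp]: "(Q + B) mod 2 ^ w = M" using X_less[of M] M_less by (simp add: M_def)
  have "0 < M" by (simp add: M_def)
  then have "R \<le> R * M" by simp
  then have [simp]: "R mod 2 ^ w = R" using X(5) by (intro mod_small) linarith
  show "triple w (I_power 0) (Block prog_blocks) 2 (I_outer R)"
    by (intro triple_Block) (use \<open>0 < M\<close> in \<open>auto simp: prog_blocks_def I_power_def I_outer_def env'_def env_def\<close>)
qed

text \<open>Partial sums never exceed the final code, which is below \<open>Q\<close> and hence fits
  into a word.\<close>

lemma sum_tail_le_offset:
  "(\<Sum>i\<in>{t..<k}. col r i * (2 ^ B) ^ card {j. j < k \<and> key j < key i}) \<le> offset r"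
  unfolding offset_def by (intro sum_mono2) auto

context
  fixes r i assumes r: "r < R" and i: "i < k"
begin

lemma triple_load_edge: "triple w (I_edge r (Suc i)) (Block prog_load_edge) 10 (I_rank r i k)"
proof -
  have [simp]: "(i + i) mod 2 ^ w = 2 * i" "(2 * i + 6) mod 2 ^ w = 6 + 2 * i"
    using X i mod_small[of "2 * i"] mod_small[of "6 + 2 * i"] by (simp_all only: mult_2 add.commute)
  have [simp]:
    "(7 + 2 * i) mod 2 ^ w = 7 + 2 * i" "i mod 2 ^ w = i" "k mod 2 ^ w = k" "key i mod 2 ^ w = key i"
    using X i key[OF i] by (auto intro!: mod_small)
  have [simp]: "(m (6 + 2 * i) * n mod 2 ^ w + m (7 + 2 * i)) mod 2 ^ w = key i"
    using mem_edges[OF i] by (simp add: mod_add_left_eq)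
  have [simp]: "{j. k \<le> j \<and> j < k \<and> key j < key i} = {}" by auto
  show "triple w (I_edge r (Suc i)) (Block prog_load_edge) 10 (I_rank r i k)"
    using i
    by (intro triple_Block)
      (simp_all add: prog_load_edge_def I_edge_def I_rank_def edge_env_def env'_def env_def w_pos)
qed

lemma triple_rank:
  "triple w (I_rank r i k) (While rJ (Block prog_compare ;; When rA (Block [Arith Mul rPow rPow rQ])))
     (k * 13 + 1) (I_rank r i 0)"
proof -
  have "triple w (I_rank r i (Suc t)) (Block prog_compare ;; When rA (Block [Arith Mul rPow rPow rQ]))
     (9 + (1 + 1)) (I_rank r i t)" if t: "t < k" for t
  proof -
    let ?C = "\<lambda>t. {j. t \<le> j \<and> j < k \<and> key j < key i}"
    \<comment> \<open>\<open>mid\<close> describes the state between the comparison and the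
      conditional multiplication.\<close>
    define mid where "mid s \<longleftrightarrow> edge_env r i s \<and> reg s rJ = t \<and>
        reg s rPow = (2 ^ B) ^ card (?C (Suc t)) \<and> reg s rA = key i - key t" for s
    have [simp]: "(t + t) mod 2 ^ w = 2 * t" "(2 * t + 6) mod 2 ^ w = 6 + 2 * t"
    using X t mod_small[of "2 * t"] mod_small[of "6 + 2 * t"] by (simp_all only: mult_2 add.commute)
  have [simp]:
      "(7 + 2 * t) mod 2 ^ w = 7 + 2 * t" "t mod 2 ^ w = t" "key t mod 2 ^ w = key t"
      "(key i - key t) mod 2 ^ w = key i - key t"
      using X t key[OF t] key[OF i] by (auto intro!: mod_small)
    have [simp]: "(m (6 + 2 * t) * n mod 2 ^ w + m (7 + 2 * t)) mod 2 ^ w = key t"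
      using mem_edges[OF t] by (simp add: mod_add_left_eq)
    have 1: "triple w (I_rank r i (Suc t)) (Block prog_compare) 9 mid"
      using t
      by (intro triple_Block)
        (simp_all add: prog_compare_def I_rank_def mid_def edge_env_def env'_def env_def)
    \<comment> \<open>Lowering the bound from \<open>Suc t\<close> to \<open>t\<close> enlarges the
      set of smaller keys exactly when edge \<open>t\<close> has a smaller key.\<close>
    have C1: "?C t = insert t (?C (Suc t))" if "key t < key i"
      using t that by (auto simp: Suc_le_eq le_less)
    have C2: "?C t = ?C (Suc t)" if "\<not> key t < key i"
      using t that by (auto simp: Suc_le_eq le_less)
    have card1: "card (?C t) = Suc (card (?C (Suc t)))" if "key t < key i"
      unfolding C1[OF that] by (subst card_insert_disjoint) auto
    have "card (?C t) \<le> card {..<k}" by (intro card_mono) auto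
    then have "((2::nat) ^ B) ^ card (?C t) \<le> Q"
      using f by (intro power_increasing) auto
    then have [simp]: "((2::nat) ^ B) ^ card (?C t) mod 2 ^ w = (2 ^ B) ^ card (?C t)"
      using Q_less X_less by simp
    have p: "(2 ^ B) ^ card (?C (Suc t)) * 2 ^ B = ((2::nat) ^ B) ^ card (?C t)" if "key t < key i"
      using card1[OF that] by simp
    have "triple w (\<lambda>s. mid s \<and> reg s rA \<noteq> 0) (Block [Arith Mul rPow rPow rQ])
        1 (I_rank r i t)"
      using t by (intro triple_Block; simp add: I_rank_def mid_def edge_env_def env'_def env_def)
        (elim conjE, simp add: p)
    then have 2: "triple w mid (When rA (Block [Arith Mul rPow rPow rQ])) (1 + 1) (I_rank r i t)"
      using t C2 by (intro triple_When) (auto simp: mid_def I_rank_def)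
    show ?thesis
      using triple_Seq[OF 1 2] by (simp add: prog_compare_def)
  qed
  moreover have "reg s rJ = 0 \<longleftrightarrow> t = 0" if "t \<le> k" "I_rank r i t s" for t s
    using that by (simp add: I_rank_def)
  ultimately have "triple w (I_rank r i k)
      (While rJ (Block prog_compare ;; When rA (Block [Arith Mul rPow rPow rQ])))
      (k * (9 + (1 + 1) + 2) + 1) (I_rank r i 0)"
    by (intro triple_While)
  then show ?thesis by simp
qed

lemma triple_bits_init:
  "triple w (I_rank r i 0) (Block [Const rCol 0, Arith Mul rJ rBits rOne]) 2 (I_bit r i B)"
proof -
  have "B < 2 ^ B" by simp
  then have [simp]: "B mod 2 ^ w = B" using q_le_Q Q_less by (intro mod_small) linarith
  \<comment> \<open>The initial accumulator 0 is right because colours have only \<open>B\<close>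
    bits.\<close>
  have [simp]: "col r i div 2 ^ B = 0" using col[OF r i] by simp
  show "triple w (I_rank r i 0) (Block [Const rCol 0, Arith Mul rJ rBits rOne])
      2 (I_bit r i B)"
    by (intro triple_Block) (auto simp: I_rank_def I_bit_def edge_env_def env'_def env_def)
qed

lemma triple_bits: "triple w (I_bit r i B) (While rJ (Block prog_bit)) (B * 11 + 1) (I_bit r i 0)"
proof -
  have "triple w (I_bit r i (Suc t)) (Block prog_bit) 9 (I_bit r i t)" if t: "t < B" for t
  proof -
    have "B < 2 ^ B" by simp
    then have [simp]: "t mod 2 ^ w = t" using t q_le_Q Q_less by (intro mod_small) linarith
    let ?g = "r * M + Q + t"
    have "r * M + M \<le> R * M" using r by (metis Suc_leI add.commute mult_Suc mult_le_mono1)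
    \<comment> \<open>The bit graph lies inside block \<open>r\<close>, so the address of its matrix
      entry stays below \<open>X\<close>.\<close>
    then have g: "?g < R * M" using t by (simp add: M_def)
    then have "Suc ?g * (n * n) \<le> R * M * (n * n)" by (intro mult_right_mono) auto
    then have "6 + 2 * k + n * n + ?g * (n * n) + key i < X"
      using X(1) key[OF i] by simp
    then have a: "(?g * (n * n) + (6 + 2 * k + n * n) + key i) mod 2 ^ w
        = 6 + 2 * k + n * n + ?g * (n * n) + key i"
      using X_less by (simp add: add_ac)
    \<comment> \<open>The intermediate results need no bounds of their own: their reductions modulo
      \<open>2 ^ w\<close> are absorbed by the last one.\<close>
    have [simp]: "((((((r * M + Q) mod 2 ^ w + t) mod 2 ^ w) * (n * n) mod 2 ^ w +
         (6 + 2 * k + n * n)) mod 2 ^ w) + key i) mod 2 ^ w = 6 + 2 * k + n * n + ?g * (n * n) + key i"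
      unfolding a[symmetric] by (simp only: mod_collapse)
    note [simp] = mem_bits[OF r t i]
    let ?c = "col r i"
    \<comment> \<open>One Horner step: the part read so far is doubled and the bit at position
      \<open>t\<close> is added.\<close>
    have c: "?c div 2 ^ t = 2 * (?c div 2 ^ Suc t) + ?c div 2 ^ t mod 2"
      by (simp add: div_mult2_eq mult.commute[of 2])
    have "?c div 2 ^ t \<le> ?c" by simp
    then have "?c div 2 ^ t < X" using col[OF r i] q_le_Q Q_less by linarith
    then have "?c div 2 ^ t < 2 ^ w" using X_less by simp
    then have [simp]: "((?c div 2 ^ Suc t + ?c div 2 ^ Suc t) mod 2 ^ w + ?c div 2 ^ t mod 2) mod 2 ^ w
        = ?c div 2 ^ t"
      using c by (simp add: mod_add_left_eq mult_2 del: power_Suc)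
    show "triple w (I_bit r i (Suc t)) (Block prog_bit) 9 (I_bit r i t)"
      using t by (intro triple_Block)
        (auto simp: prog_bit_def I_bit_def edge_env_def env'_def env_def simp del: power_Suc)
  qed
  moreover have "reg s rJ = 0 \<longleftrightarrow> t = 0" if "t \<le> B" "I_bit r i t s" for t s
    using that by (simp add: I_bit_def)
  ultimately have "triple w (I_bit r i B) (While rJ (Block prog_bit)) (B * (9 + 2) + 1) (I_bit r i 0)"
    by (intro triple_While)
  then show ?thesis by simp
qed

lemma triple_accumulate:
  "triple w (I_bit r i 0) (Block [Arith Mul rCol rCol rPow, Arith Add rOffset rOffset rCol]) 2 (I_edge r i)"
proof -
  let ?h = "\<lambda>i. col r i * (2 ^ B) ^ card {j. j < k \<and> key j < key i}"
  have s: "sum ?h {i..<k} = sum ?h {Suc i..<k} + ?h i"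
    using i by (simp add: sum.atLeast_Suc_lessThan)
  have "sum ?h {i..<k} < X"
    using sum_tail_le_offset[of r i] offset_less[OF r] Q_less by linarith
  then have "sum ?h {i..<k} < 2 ^ w" using X_less by simp
  then have [simp]: "(sum ?h {Suc i..<k} + ?h i mod 2 ^ w) mod 2 ^ w = sum ?h {i..<k}"
    unfolding s by (simp add: mod_add_right_eq)
  show "triple w (I_bit r i 0) (Block [Arith Mul rCol rCol rPow, Arith Add rOffset rOffset rCol])
      2 (I_edge r i)"
    using i by (intro triple_Block) (auto simp: I_bit_def I_edge_def edge_env_def env'_def env_def)
qed

lemma triple_edge: "triple w (I_edge r (Suc i)) prog_edge (k * 13 + B * 11 + 16) (I_edge r i)"
  using triple_Seq[OF triple_load_edge triple_Seq[OF triple_rank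
    triple_Seq[OF triple_bits_init triple_Seq[OF triple_bits triple_accumulate]]]]
  by (simp add: prog_edge_def add_ac)

end

lemma triple_edges:
  assumes "r < R"
  shows "triple w (I_edge r k) (While rI prog_edge) (k * (k * 13 + B * 11 + 18) + 1) (I_edge r 0)"
proof -
  have "triple w (I_edge r k) (While rI prog_edge) (k * ((k * 13 + B * 11 + 16) + 2) + 1) (I_edge r 0)"
    by (intro triple_While triple_edge assms) (auto simp: I_edge_def)
  then show ?thesis by (simp add: add_ac)
qed

lemma triple_outer:
  "triple w (I_outer R)
     (While rOuter
       (Block [Const rOffset 0, Arith Mul rI rFails rOne] ;;
        While rI prog_edge ;;
        Block [Arith Add rA rFirst rOffset, Emit rA, Arith Add rFirst rFirst rBlock,
               Arith Sub rOuter rOuter rOne]))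
     (R * (k * (k * 13 + B * 11 + 18) + 9) + 1) (I_outer 0)"
proof -
  let ?T = "k * (k * 13 + B * 11 + 18)"
  have "triple w (I_outer (Suc t)) (Block [Const rOffset 0, Arith Mul rI rFails rOne] ;;
        While rI prog_edge ;;
        Block [Arith Add rA rFirst rOffset, Emit rA, Arith Add rFirst rFirst rBlock,
               Arith Sub rOuter rOuter rOne]) (2 + ((?T + 1) + 4)) (I_outer t)" if t: "t < R" for t
  proof (intro triple_Seq)
    let ?r = "R - Suc t"
    have r: "?r < R" using t by simp
    have [simp]: "k mod 2 ^ w = k" using X X_less[of k] by simp
    show "triple w (I_outer (Suc t)) (Block [Const rOffset 0, Arith Mul rI rFails rOne])
        2 (I_edge ?r k)"
      using t by (intro triple_Block) (auto simp: I_outer_def I_edge_def env'_def env_def)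
    show "triple w (I_edge ?r k) (While rI prog_edge) (?T + 1) (I_edge ?r 0)"
      by (rule triple_edges[OF r])
    have sM: "?r * M + M = (R - t) * M" using t by (metis Suc_diff_Suc add.commute mult_Suc)
    have le: "(R - t) * M \<le> R * M" by simp
    then have m1: "((R - t) * M) mod 2 ^ w = (R - t) * M"
      using X by (intro mod_small) linarith
    have "?r * M + offset ?r < X" using offset_less[OF r] sM le X(5) M_def by linarith
    then have m2: "(?r * M + offset ?r) mod 2 ^ w = ?r * M + offset ?r"
      using X_less by simp
    have "0 < M" by (simp add: M_def)
    then have "R \<le> R * M" by simp
    then have [simp]: "t mod 2 ^ w = t" using X t by (intro mod_small) linarith
    have u: "[0..<R - t] = [0..<?r] @ [?r]" using t by (metis Suc_diff_Suc upt_Suc_append zero_le)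
    have o: "(\<Sum>i = 0..<k. col ?r i * (2 ^ B) ^ card {j. j < k \<and> key j < key i}) = offset ?r"
      unfolding offset_def by (simp add: atLeast0LessThan)
    show "triple w (I_edge ?r 0) (Block [Arith Add rA rFirst rOffset, Emit rA, Arith Add rFirst rFirst rBlock,
               Arith Sub rOuter rOuter rOne]) 4 (I_outer t)"
      using triple_Block[of "I_edge ?r 0" "I_outer t" w "[Arith Add rA rFirst rOffset, Emit rA,
          Arith Add rFirst rFirst rBlock, Arith Sub rOuter rOuter rOne]" 4] t
      by (auto simp: I_outer_def I_edge_def env'_def env_def sM m1 m2 u o)
  qed
  moreover have "reg s rOuter = 0 \<longleftrightarrow> t = 0" if "t \<le> R" "I_outer t s" for t s
    using that by (simp add: I_outer_def)
  ultimately have "triple w (I_outer R)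
     (While rOuter
       (Block [Const rOffset 0, Arith Mul rI rFails rOne] ;;
        While rI prog_edge ;;
        Block [Arith Add rA rFirst rOffset, Emit rA, Arith Add rFirst rFirst rBlock,
               Arith Sub rOuter rOuter rOne])) (R * ((2 + ((?T + 1) + 4)) + 2) + 1) (I_outer 0)"
    by (intro triple_While)
  then show ?thesis by (simp add: add_ac)
qed

lemma triple_query_prog:
  assumes "mem s0 = m" "emitted s0 = []"
  shows "triple w ((=) s0) query_prog
     (R * (k * (k * 13 + B * 11 + 18) + 9) + B * 7 + f * 4 + 30)
     (\<lambda>s. emitted s = map (\<lambda>r. r * M + offset r) [0..<R])"
proof -
  \<comment> \<open>The constant 30 collects the straight-line code outside the loops and the final
    loop tests: 25 + 1 + 1 + 2 + 1.\<close>
  have "triple w ((=) s0) query_prog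
     (25 + (B * 7 + 1 + (f * 4 + 1 + (2 + (R * (k * (k * 13 + B * 11 + 18) + 9) + 1))))) (I_outer 0)"
    unfolding query_prog_def
    by (rule triple_Seq[OF triple_init[OF assms] triple_Seq[OF triple_double triple_Seq[OF triple_power
      triple_Seq[OF triple_blocks triple_outer]]]])
  then show ?thesis
    by (simp add: triple_def I_outer_def add_ac) blast
qed

end

section \<open>Colourings that separate paths from failures\<close>

lemma digit_sum_less:
  fixes d :: "nat \<Rightarrow> nat"
  assumes "\<And>i. i < m \<Longrightarrow> d i < q"
  shows "(\<Sum>i<m. d i * q ^ i) < q ^ m"
  using assms
proof (induction m)
  case (Suc m)
  have "(\<Sum>i<Suc m. d i * q ^ i) < q ^ m + d m * q ^ m" using Suc by simp
  also have "\<dots> = Suc (d m) * q ^ m" by simp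
  also have "\<dots> \<le> q * q ^ m" using Suc.prems[of m] by (intro mult_right_mono) auto
  finally show ?case by simp
qed simp

lemma digit_sum_digit:
  fixes d :: "nat \<Rightarrow> nat"
  assumes d: "\<And>i. i < m \<Longrightarrow> d i < q" and "j < m"
  shows "(\<Sum>i<m. d i * q ^ i) div q ^ j mod q = d j"
proof -
  have q: "0 < q" using d[OF \<open>j < m\<close>] by simp
  \<comment> \<open>The sum is split at position \<open>j\<close>: the lower digits sum to less than
    \<open>q ^ j\<close>, the upper ones to a multiple of \<open>q ^ Suc j\<close>.\<close>
  have "(\<Sum>i<m. d i * q ^ i) = (\<Sum>i<j. d i * q ^ i) + d j * q ^ j + (\<Sum>i\<in>{Suc j..<m}. d i * q ^ i)"
    using \<open>j < m\<close> sum.atLeastLessThan_concat[of 0 j m "\<lambda>i. d i * q ^ i"]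
    by (simp add: lessThan_atLeast0 sum.atLeast_Suc_lessThan[of j m])
  also have "(\<Sum>i\<in>{Suc j..<m}. d i * q ^ i) = q ^ j * (q * (\<Sum>i\<in>{Suc j..<m}. d i * q ^ (i - Suc j)))"
    unfolding sum_distrib_left
  proof (intro sum.cong refl)
    fix i assume i: "i \<in> {Suc j..<m}"
    then have "q ^ i = q ^ j * q * q ^ (i - Suc j)"
      by (metis atLeastLessThan_iff le_add_diff_inverse mult.commute power_Suc power_add)
    then show "d i * q ^ i = q ^ j * (q * (d i * q ^ (i - Suc j)))" by simp
  qed
  finally have "(\<Sum>i<m. d i * q ^ i) =
      (\<Sum>i<j. d i * q ^ i) + q ^ j * (d j + q * (\<Sum>i\<in>{Suc j..<m}. d i * q ^ (i - Suc j)))"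
    by (simp add: algebra_simps)
  moreover have "(\<Sum>i<j. d i * q ^ i) < q ^ j"
    using d \<open>j < m\<close> by (intro digit_sum_less) auto
  ultimately show ?thesis using d[OF \<open>j < m\<close>] q by simp
qed

text \<open>Placing colours by rank makes the code independent of the order in which \<open>F\<close> is listed.\<close>

definition rank_in :: "('a \<Rightarrow> nat) \<Rightarrow> 'a set \<Rightarrow> 'a \<Rightarrow> nat" where
  "rank_in key F e = card {e' \<in> F. key e' < key e}"

definition colour_code :: "('a \<Rightarrow> nat) \<Rightarrow> nat \<Rightarrow> ('a \<Rightarrow> nat) \<Rightarrow> 'a set \<Rightarrow> nat" where
  "colour_code key q h F = (\<Sum>e\<in>F. h e * q ^ rank_in key F e)"

definition digits :: "nat \<Rightarrow> nat \<Rightarrow> nat \<Rightarrow> nat set" where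
  "digits q f x = (\<lambda>j. x div q ^ j mod q) ` {..<f}"

section \<open>Ranks and the digits of colour codes\<close>

text \<open>A larger key gives a strictly larger rank, so ranks are injective; as they lie below
  \<open>card F\<close>, counting shows that they exhaust this range.\<close>

lemma bij_betw_rank_in:
  assumes "finite F" "inj_on key F"
  shows "bij_betw (rank_in key F) F {..<card F}"
proof -
  have less: "rank_in key F a < rank_in key F b" if "a \<in> F" "key a < key b" for a b
    unfolding rank_in_def using that assms(1) by (intro psubset_card_mono) auto
  have inj: "inj_on (rank_in key F) F"
  proof (rule inj_onI)
    fix a b assume ab: "a \<in> F" "b \<in> F" "rank_in key F a = rank_in key F b"
    then have "key a = key b" using less by (metis less_irrefl linorder_less_linear)
    then show "a = b" using assms(2) ab by (auto dest: inj_onD)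
  qed
  have "rank_in key F ` F \<subseteq> {..<card F}"
    unfolding rank_in_def using assms(1) by (auto intro!: psubset_card_mono)
  then have "rank_in key F ` F = {..<card F}"
    using card_image[OF inj] by (intro card_subset_eq) auto
  then show ?thesis using inj by (simp add: bij_betw_def)
qed

context
  fixes F :: "'a set" and key h :: "'a \<Rightarrow> nat" and q f :: nat
  assumes F: "finite F" "inj_on key F" "card F \<le> f" and h: "\<And>e. e \<in> F \<Longrightarrow> h e < q" and q: "0 < q"
begin

text \<open>Sorting \<open>F\<close> by key turns the code into an ordinary expansion with
  \<open>f\<close> digits, padded with zeros, to which digit extraction applies.\<close>

lemma colour_code_eq:
  "colour_code key q h F =
     (\<Sum>i<f. (if i < card F then h (the_inv_into F (rank_in key F) i) else 0) * q ^ i)"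
proof -
  let ?e = "the_inv_into F (rank_in key F)"
  note b = bij_betw_rank_in[OF F(1,2)]
  have "colour_code key q h F = (\<Sum>i<card F. h (?e i) * q ^ i)"
    unfolding colour_code_def sum.reindex_bij_betw[OF b, symmetric]
    by (simp add: the_inv_into_f_f[OF bij_betw_imp_inj_on[OF b]])
  also have "\<dots> = (\<Sum>i<f. (if i < card F then h (?e i) else 0) * q ^ i)"
    using F(3) by (intro sum.mono_neutral_cong_left) auto
  finally show ?thesis .
qed

lemma the_inv_rank: "i < card F \<Longrightarrow> the_inv_into F (rank_in key F) i \<in> F"
  using bij_betw_the_inv_into[OF bij_betw_rank_in[OF F(1,2)]] by (auto simp: bij_betw_def)

lemma colour_code_less: "colour_code key q h F < q ^ f"
  unfolding colour_code_eq using h the_inv_rank q by (intro digit_sum_less) auto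

text \<open>The extra digit 0 comes from the padding positions, which exist iff
  \<open>card F < f\<close>.\<close>

lemma digits_colour_code:
  "digits q f (colour_code key q h F) = h ` F \<union> (if card F < f then {0} else {})"
proof -
  let ?e = "the_inv_into F (rank_in key F)"
  have "digits q f (colour_code key q h F) = (\<lambda>j. if j < card F then h (?e j) else 0) ` {..<f}"
    unfolding digits_def colour_code_eq using h the_inv_rank q
    by (intro image_cong refl digit_sum_digit) auto
  also have "{..<f} = {..<card F} \<union> {card F..<f}" using F(3) by auto
  also have "(\<lambda>j. if j < card F then h (?e j) else 0) ` \<dots> =
      h ` ?e ` {..<card F} \<union> (if card F < f then {0} else {})"
    by (auto simp: image_Un image_image)
  also have "?e ` {..<card F} = F"
    using bij_betw_the_inv_into[OF bij_betw_rank_in[OF F(1,2)]] by (auto simp: bij_betw_def)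
  finally show ?thesis .
qed

end

text \<open>
  The code of fewer than \<open>f\<close> edges has leading digits 0, so that colour 0 must be avoided as well.
\<close>

definition separates :: "nat \<Rightarrow> ('a \<Rightarrow> nat) \<Rightarrow> 'a set \<Rightarrow> 'a set \<Rightarrow> bool" where
  "separates f h F P \<longleftrightarrow> h ` P \<inter> (h ` F \<union> (if card F < f then {0} else {})) = {}"

section \<open>Counting the colourings that separate a path from the failures\<close>

text \<open>Each colouring \<open>g\<close> of the failures is extended by letting the edges of
  \<open>P\<close> avoid the forbidden colours and leaving the other edges free. The extensions of
  different \<open>g\<close> are disjoint, so their numbers add up.\<close>

lemma card_separating_ge:
  fixes E F P :: "'a set"
  assumes fin: "finite E" and FP: "F \<subseteq> E" "P \<subseteq> E" "F \<inter> P = {}"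
    and \<G>: "\<G> \<subseteq> F \<rightarrow>\<^sub>E {..<q}"
    and a: "\<And>g. g \<in> \<G> \<Longrightarrow> a \<le> card ({..<q} - (g ` F \<union> (if card F < f then {0} else {})))"
  shows "card \<G> * (a ^ card P * q ^ card (E - F - P)) \<le> card {h \<in> E \<rightarrow>\<^sub>E {..<q}. separates f h F P}"
proof -
  \<comment> \<open>\<open>U g e\<close> is the palette of the edge \<open>e\<close>; the product of
    the palette sizes counts the extensions of \<open>g\<close>.\<close>
  define U where "U g = (\<lambda>e. if e \<in> F then {g e} else if e \<in> P
      then {..<q} - (g ` F \<union> (if card F < f then {0} else {})) else {..<q})" for g :: "'a \<Rightarrow> nat"
  have finF: "finite F" "finite P" using fin FP by (auto intro: finite_subset)
  have finG: "finite \<G>" using finite_subset[OF \<G>] finF by (simp add: finite_PiE)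
  have cardU: "a ^ card P * q ^ card (E - F - P) \<le> card (Pi\<^sub>E E (U g))" if g: "g \<in> \<G>" for g
  proof -
    have "E = F \<union> (P \<union> (E - F - P))" using FP by auto
    then have "(\<Prod>e\<in>E. card (U g e)) = (\<Prod>e\<in>F \<union> (P \<union> (E - F - P)). card (U g e))" by simp
    also have "\<dots> = (\<Prod>e\<in>F. card (U g e)) * ((\<Prod>e\<in>P. card (U g e)) * (\<Prod>e\<in>E - F - P. card (U g e)))"
      using fin finF FP by (subst prod.union_disjoint; (subst prod.union_disjoint)?) auto
    also have "(\<Prod>e\<in>F. card (U g e)) = 1" by (simp add: U_def)
    also have "(\<Prod>e\<in>E - F - P. card (U g e)) = q ^ card (E - F - P)" by (simp add: U_def)
    also have "(\<Prod>e\<in>P. card (U g e)) =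
        card ({..<q} - (g ` F \<union> (if card F < f then {0} else {}))) ^ card P"
      using FP by (subst prod.cong[OF refl, where h = "\<lambda>_. card ({..<q} - (g ` F \<union> (if card F < f then {0} else {})))"])
        (auto simp: U_def)
    finally have "card (Pi\<^sub>E E (U g)) =
        card ({..<q} - (g ` F \<union> (if card F < f then {0} else {}))) ^ card P * q ^ card (E - F - P)"
      using fin by (simp add: card_PiE)
    then show ?thesis using a[OF g] by (simp add: power_mono)
  qed
  have disj: "Pi\<^sub>E E (U g) \<inter> Pi\<^sub>E E (U g') = {}" if "g \<in> \<G>" "g' \<in> \<G>" "g \<noteq> g'" for g g'
  proof (rule ccontr)
    assume "Pi\<^sub>E E (U g) \<inter> Pi\<^sub>E E (U g') \<noteq> {}"
    then obtain h where "h \<in> Pi\<^sub>E E (U g)" "h \<in> Pi\<^sub>E E (U g')" by auto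
    then have "h e \<in> U g e" "h e \<in> U g' e" if "e \<in> F" for e
      using that FP(1) by (auto simp: PiE_iff)
    then have "g e = g' e" if "e \<in> F" for e using that by (simp add: U_def)
    then have "g = g'" using \<G> that(1,2) by (intro PiE_ext[of g F "\<lambda>_. {..<q}" g']) auto
    then show False using that by simp
  qed
  have sub: "Pi\<^sub>E E (U g) \<subseteq> {h \<in> E \<rightarrow>\<^sub>E {..<q}. separates f h F P}" if "g \<in> \<G>" for g
  proof
    fix h assume h: "h \<in> Pi\<^sub>E E (U g)"
    have gF: "g e < q" if "e \<in> F" for e using \<G> \<open>g \<in> \<G>\<close> that by (auto simp: PiE_iff)
    have hF: "h e = g e" if "e \<in> F" for e
    proof -
      have "h e \<in> U g e" using h that FP(1) by (auto simp: PiE_iff)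
      then show ?thesis using that by (simp add: U_def)
    qed
    have hP: "h e \<in> {..<q} - (g ` F \<union> (if card F < f then {0} else {}))" if "e \<in> P" for e
    proof -
      have "h e \<in> U g e" using h that FP(2) by (auto simp: PiE_iff)
      then show ?thesis using that FP(3) by (auto simp: U_def split: if_splits)
    qed
    have "h e < q" if "e \<in> E" for e
    proof -
      have "h e \<in> U g e" using h that by (auto simp: PiE_iff)
      then show ?thesis using gF by (auto simp: U_def split: if_splits)
    qed
    then have "h \<in> E \<rightarrow>\<^sub>E {..<q}" using h by (auto simp: PiE_iff)
    moreover have "h ` F = g ` F" using hF by auto
    ultimately show "h \<in> {h \<in> E \<rightarrow>\<^sub>E {..<q}. separates f h F P}"
      using hP unfolding separates_def by blast
  qed
  have finT: "finite {h \<in> E \<rightarrow>\<^sub>E {..<q}. separates f h F P}"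
    using fin by (simp add: finite_PiE)
  have "card \<G> * (a ^ card P * q ^ card (E - F - P)) = (\<Sum>g\<in>\<G>. a ^ card P * q ^ card (E - F - P))"
    by simp
  also have "\<dots> \<le> (\<Sum>g\<in>\<G>. card (Pi\<^sub>E E (U g)))" using cardU by (intro sum_mono) auto
  also have "\<dots> = card (\<Union>g\<in>\<G>. Pi\<^sub>E E (U g))"
    using finG disj finite_subset[OF sub finT] by (intro card_UN_disjoint[symmetric]) auto
  also have "\<dots> \<le> card {h \<in> E \<rightarrow>\<^sub>E {..<q}. separates f h F P}"
    using finT sub by (intro card_mono) auto
  finally show ?thesis .
qed

text \<open>With \<open>b = 2 * a - f\<close> the quotient of the bases is \<open>1 + f / b\<close>,
  which is at most \<open>exp (f / b)\<close>. Since \<open>c \<le> b\<close>, its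
  \<open>c\<close>-th power is at most \<open>exp f\<close>, and \<open>exp 1\<close> is below
  4.\<close>

lemma power_le_four_power:
  fixes f a c :: nat
  assumes "f < a" "c \<le> a"
  shows "(2 * a) ^ c \<le> 4 ^ f * (2 * a - f) ^ c"
proof -
  define b where "b = real (2 * a - f)"
  have b: "b \<ge> real a" "b > 0" "real (2 * a) = b + real f" using assms by (auto simp: b_def)
  have "real (2 * a) = (1 + real f / b) * b" using b by (simp add: field_simps)
  then have "real ((2 * a) ^ c) = (1 + real f / b) ^ c * b ^ c"
    unfolding of_nat_power by (simp only: power_mult_distrib)
  also have "(1 + real f / b) ^ c \<le> exp (real f / b) ^ c"
    using b by (intro power_mono exp_ge_add_one_self) auto
  also have "\<dots> = exp (real f * (real c / b))" by (simp add: exp_of_nat_mult[symmetric] mult_ac)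
  also have "\<dots> \<le> exp (real f * 1)"
    using b assms by (subst exp_le_cancel_iff, intro mult_left_mono) auto
  also have "\<dots> = exp 1 ^ f" by (simp add: exp_of_nat_mult[symmetric])
  also have "\<dots> \<le> 4 ^ f" using exp_le by (intro power_mono) auto
  finally have "real ((2 * a) ^ c) \<le> 4 ^ f * b ^ c" using b by (simp add: mult_right_mono)
  then have "real ((2 * a) ^ c) \<le> real (4 ^ f * (2 * a - f) ^ c)" by (simp add: b_def)
  then show ?thesis by (simp only: of_nat_le_iff)
qed

lemma card_separating:
  fixes E F P :: "'a set"
  assumes fin: "finite E" and FP: "F \<subseteq> E" "P \<subseteq> E" "F \<inter> P = {}" and F: "card F \<le> f" and P: "card P \<le> a"
  shows "card (E \<rightarrow>\<^sub>E {..<2 * a}) \<le> 4 ^ f * card {h \<in> E \<rightarrow>\<^sub>E {..<2 * a}. separates f h F P}"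
proof -
  have finF: "finite F" "finite P" using fin FP by (auto intro: finite_subset)
  let ?N = "card {h \<in> E \<rightarrow>\<^sub>E {..<2 * a}. separates f h F P}"
  let ?e = "card (E - F - P)"
  have "card E = card F + card P + ?e"
  proof -
    have "E = F \<union> P \<union> (E - F - P)" using FP by auto
    then have "card E = card (F \<union> P \<union> (E - F - P))" by simp
    also have "\<dots> = card (F \<union> P) + ?e" using fin finF by (intro card_Un_disjoint) auto
    finally show ?thesis using finF FP(3) by (simp add: card_Un_disjoint)
  qed
  then have E: "card (E \<rightarrow>\<^sub>E {..<2 * a}) = (2 * a) ^ card F * ((2 * a) ^ card P * (2 * a) ^ ?e)"
    using fin by (simp add: card_PiE power_add)
  show ?thesis
  proof (cases "a \<le> f")
    case True
    \<comment> \<open>Colour \<open>F\<close> with the lower half of the palette and \<open>P\<close> with the upper half.\<close>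
    have "a \<le> card ({..<2 * a} - (g ` F \<union> (if card F < f then {0} else {})))"
      if g: "g \<in> F \<rightarrow>\<^sub>E {..<a}" for g
    proof -
      have "{a..<2 * a} \<subseteq> {..<2 * a} - (g ` F \<union> (if card F < f then {0} else {}))"
        using g by (auto simp: PiE_iff)
      then have "card {a..<2 * a} \<le> card ({..<2 * a} - (g ` F \<union> (if card F < f then {0} else {})))"
        by (intro card_mono) auto
      then show ?thesis by simp
    qed
    moreover have "(F \<rightarrow>\<^sub>E {..<a}) \<subseteq> (F \<rightarrow>\<^sub>E {..<2 * a})" by (intro PiE_mono) auto
    ultimately have "card (F \<rightarrow>\<^sub>E {..<a}) * (a ^ card P * (2 * a) ^ ?e) \<le> ?N"
      by (intro card_separating_ge fin FP)
    then have N: "a ^ card F * (a ^ card P * (2 * a) ^ ?e) \<le> ?N" using finF by (simp add: card_PiE)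
    \<comment> \<open>Restricting an edge to one half of the palette costs a factor 2; this concerns
      at most \<open>f\<close> edges of \<open>F\<close> and at most \<open>a \<le> f\<close> edges
      of \<open>P\<close>.\<close>
    have "(2::nat) ^ card F * 2 ^ card P \<le> 2 ^ f * 2 ^ f"
      using F P True by (intro mult_mono power_increasing) auto
    also have "\<dots> = 4 ^ f" by (simp flip: power_mult_distrib)
    finally have "(2 ^ card F * 2 ^ card P) * (a ^ card F * (a ^ card P * (2 * a) ^ ?e)) \<le> 4 ^ f * ?N"
      using N by (intro mult_mono) auto
    then show ?thesis unfolding E by (simp add: power_mult_distrib mult_ac)
  next
    case False
    have "2 * a - f \<le> card ({..<2 * a} - (g ` F \<union> (if card F < f then {0} else {})))" for g :: "'a \<Rightarrow> nat"
    proof -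
      \<comment> \<open>Colour 0 is forbidden in addition only if \<open>F\<close> has fewer than
        \<open>f\<close> edges, so at most \<open>f\<close> colours are forbidden in every
        case.\<close>
      have "card (g ` F \<union> (if card F < f then {0} else {})) \<le> f"
      proof -
        have "card (g ` F \<union> (if card F < f then {0} else {})) \<le> card (g ` F) + card (if card F < f then {0::nat} else {})"
          by (rule card_Un_le)
        also have "\<dots> \<le> f" using card_image_le[OF finF(1), of g] F by (auto split: if_splits)
        finally show ?thesis .
      qed
      moreover have "card {..<2 * a} - card (g ` F \<union> (if card F < f then {0} else {})) \<le>
          card ({..<2 * a} - (g ` F \<union> (if card F < f then {0} else {})))"
        using finF by (intro diff_card_le_card_Diff) auto
      ultimately show ?thesis by simp
    qed
    then have "card (F \<rightarrow>\<^sub>E {..<2 * a}) * ((2 * a - f) ^ card P * (2 * a) ^ ?e) \<le> ?N"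
      by (intro card_separating_ge fin FP) auto
    then have N: "(2 * a) ^ card F * ((2 * a - f) ^ card P * (2 * a) ^ ?e) \<le> ?N"
      using finF by (simp add: card_PiE)
    have "(2 * a) ^ card P \<le> 4 ^ f * (2 * a - f) ^ card P"
      using False P by (intro power_le_four_power) auto
    then have "card (E \<rightarrow>\<^sub>E {..<2 * a}) \<le>
        (2 * a) ^ card F * ((4 ^ f * (2 * a - f) ^ card P) * (2 * a) ^ ?e)"
      unfolding E by (intro mult_mono) auto
    also have "\<dots> = 4 ^ f * ((2 * a) ^ card F * ((2 * a - f) ^ card P * (2 * a) ^ ?e))"
      by (simp add: mult_ac)
    also have "\<dots> \<le> 4 ^ f * ?N" using N by (intro mult_left_mono) auto
    finally show ?thesis .
  qed
qed

section \<open>Derandomization by repeated averaging\<close>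

text \<open>Double counting of the good pairs: if every \<open>h\<close> were good for less than a
  fraction \<open>1 / D\<close> of \<open>C\<close>, the total would fall short of what the elements
  of \<open>C\<close> contribute.\<close>

lemma averaging:
  fixes \<Omega> :: "'h set" and C :: "'c set"
  assumes "finite \<Omega>" "\<Omega> \<noteq> {}" "finite C"
    and good: "\<And>c. c \<in> C \<Longrightarrow> card \<Omega> \<le> D * card {h \<in> \<Omega>. good h c}"
  shows "\<exists>h\<in>\<Omega>. card C \<le> D * card {c \<in> C. good h c}"
proof (rule ccontr)
  assume "\<not> ?thesis"
  then have less: "D * card {c \<in> C. good h c} < card C" if "h \<in> \<Omega>" for h using that by force
  have "card C * card \<Omega> \<le> (\<Sum>c\<in>C. D * card {h \<in> \<Omega>. good h c})"
    using sum_mono[OF good] by simp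
  also have "\<dots> = D * (\<Sum>c\<in>C. \<Sum>h\<in>\<Omega>. of_bool (good h c))"
    using assms by (simp add: sum_distrib_left Int_def)
  also have "\<dots> = D * (\<Sum>h\<in>\<Omega>. \<Sum>c\<in>C. of_bool (good h c))"
    by (subst sum.swap) simp
  also have "\<dots> = (\<Sum>h\<in>\<Omega>. D * card {c \<in> C. good h c})"
    using assms by (simp add: sum_distrib_left Int_def)
  also have "\<dots> < (\<Sum>h\<in>\<Omega>. card C)" using assms less by (intro sum_strict_mono) auto
  finally show False by (simp add: mult.commute)
qed

text \<open>Averaging over the elements not yet served yields a next member that leaves at most the
  fraction \<open>(D - 1) / D\<close> of them. The bound is multiplied out to stay within the
  natural numbers.\<close>

lemma iterated_averaging:
  fixes \<Omega> :: "'h set" and C :: "'c set"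
  assumes "finite \<Omega>" "\<Omega> \<noteq> {}" "finite C" "0 < D"
    and good: "\<And>c. c \<in> C \<Longrightarrow> card \<Omega> \<le> D * card {h \<in> \<Omega>. good h c}"
  shows "\<exists>hs. (\<forall>r. hs r \<in> \<Omega>) \<and>
    D ^ R * card {c \<in> C. \<forall>r<R. \<not> good (hs r) c} \<le> (D - 1) ^ R * card C"
proof (induction R)
  case 0
  then show ?case using assms(2) by auto
next
  case (Suc R)
  then obtain hs where hs: "\<forall>r. hs r \<in> \<Omega>"
    "D ^ R * card {c \<in> C. \<forall>r<R. \<not> good (hs r) c} \<le> (D - 1) ^ R * card C" by blast
  let ?C = "{c \<in> C. \<forall>r<R. \<not> good (hs r) c}"
  obtain h where h: "h \<in> \<Omega>" "card ?C \<le> D * card {c \<in> ?C. good h c}"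
    using averaging[of \<Omega> ?C D good] assms by auto
  let ?hs = "hs(R := h)"
  have eq: "{c \<in> C. \<forall>r<Suc R. \<not> good (?hs r) c} = ?C - {c \<in> ?C. good h c}"
    by (auto simp: less_Suc_eq)
  have "card (?C - {c \<in> ?C. good h c}) = card ?C - card {c \<in> ?C. good h c}"
    using assms(3) by (intro card_Diff_subset) auto
  then have "D * card (?C - {c \<in> ?C. good h c}) \<le> (D - 1) * card ?C"
    using h(2) by (simp add: algebra_simps diff_mult_distrib)
  then have "D ^ R * (D * card (?C - {c \<in> ?C. good h c})) \<le> D ^ R * ((D - 1) * card ?C)"
    by (rule mult_left_mono) simp
  also have "\<dots> = (D - 1) * (D ^ R * card ?C)" by simp
  also have "\<dots> \<le> (D - 1) * ((D - 1) ^ R * card C)" using hs(2) by (rule mult_left_mono) simp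
  finally have "D ^ Suc R * card {c \<in> C. \<forall>r<Suc R. \<not> good (?hs r) c} \<le> (D - 1) ^ Suc R * card C"
    unfolding eq by (simp add: mult_ac)
  then show ?case using hs(1) h(1) by (intro exI[of _ ?hs]) auto
qed

text \<open>\<open>(1 - 1 / D) ^ D\<close> is at most \<open>exp (- 1)\<close>, hence at most one
  half.\<close>

lemma two_pred_power_le: "0 < D \<Longrightarrow> 2 * (D - 1) ^ D \<le> (D::nat) ^ D"
proof -
  assume D: "0 < D"
  have "(1 - 1 / real D) ^ D \<le> exp (- (1 / real D)) ^ D"
    using D exp_ge_add_one_self[of "- (1 / real D)"] by (intro power_mono) auto
  also have "\<dots> = exp (- 1)" using D by (simp add: exp_of_nat_mult[symmetric])
  also have "\<dots> \<le> 1 / 2" using exp_ge_add_one_self[of 1] by (simp add: exp_minus field_simps)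
  finally have "(1 - 1 / real D) ^ D * real D ^ D \<le> 1 / 2 * real D ^ D"
    by (intro mult_right_mono) auto
  then have "real (2 * (D - 1) ^ D) \<le> real (D ^ D)"
    using D by (simp add: algebra_simps of_nat_diff flip: power_mult_distrib)
  then show ?thesis by (simp only: of_nat_le_iff)
qed

text \<open>Every \<open>D\<close> rounds at least halve the bound on the unserved part, so after
  \<open>D * N\<close> rounds less than one of the fewer than \<open>2 ^ N\<close> elements is
  left.\<close>

lemma covering_sequence_exists:
  fixes \<Omega> :: "'h set" and C :: "'c set"
  assumes "finite \<Omega>" "\<Omega> \<noteq> {}" "finite C" "0 < D" "card C < 2 ^ N"
    and good: "\<And>c. c \<in> C \<Longrightarrow> card \<Omega> \<le> D * card {h \<in> \<Omega>. good h c}"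
  shows "\<exists>hs. (\<forall>r. hs r \<in> \<Omega>) \<and> (\<forall>c\<in>C. \<exists>r<D * N. good (hs r) c)"
proof -
  obtain hs where hs: "\<forall>r. hs r \<in> \<Omega>"
    "D ^ (D * N) * card {c \<in> C. \<forall>r<D * N. \<not> good (hs r) c} \<le> (D - 1) ^ (D * N) * card C"
    using iterated_averaging[of \<Omega> C D good] assms by blast
  let ?b = "card {c \<in> C. \<forall>r<D * N. \<not> good (hs r) c}"
  have "?b = 0"
  proof (rule ccontr)
    assume "?b \<noteq> 0"
    then have "D ^ (D * N) * 1 \<le> D ^ (D * N) * ?b" by (intro mult_left_mono) auto
    also note hs(2)
    finally have 1: "D ^ (D * N) \<le> (D - 1) ^ (D * N) * card C" by simp
    have "2 ^ N * (D - 1) ^ (D * N) = (2 * (D - 1) ^ D) ^ N" by (simp add: power_mult power_mult_distrib)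
    also have "\<dots> \<le> (D ^ D) ^ N" using two_pred_power_le assms(4) by (intro power_mono) auto
    also have "\<dots> \<le> (D - 1) ^ (D * N) * card C" using 1 by (simp add: power_mult)
    \<comment> \<open>Cancelling leaves the case of a vanishing factor, possible for
      \<open>D = 1\<close>; it contradicts the positivity of \<open>D ^ (D * N)\<close>.\<close>
    finally have "(D - 1) ^ (D * N) = 0 \<or> 2 ^ N \<le> card C"
      unfolding mult.commute[of "2 ^ N"] mult_le_cancel1 by blast
    moreover have "0 < D ^ (D * N)" using assms(4) by simp
    ultimately show False using 1 assms(5) by (metis leD mult_0)
  qed
  then show ?thesis using hs(1) assms(3) by auto
qed

lemma card_subsets_le:
  assumes "finite A"
  shows "card {F. F \<subseteq> A \<and> card F \<le> f} \<le> (card A + 1) ^ f"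
proof -
  have "{F. F \<subseteq> A \<and> card F \<le> f} \<subseteq>
      (\<lambda>g. the ` (g ` {..<f} - {None})) ` ({..<f} \<rightarrow>\<^sub>E (insert None (Some ` A)))"
  proof
    fix F assume "F \<in> {F. F \<subseteq> A \<and> card F \<le> f}"
    then have F: "F \<subseteq> A" "card F \<le> f" "finite F" using assms finite_subset by auto
    obtain e where e: "bij_betw e {..<card F} F"
      using ex_bij_betw_nat_finite[OF F(3)] by (auto simp: atLeast0LessThan)
    let ?g = "\<lambda>i\<in>{..<f}. if i < card F then Some (e i) else None"
    have "?g ` {..<f} - {None} = Some ` e ` {..<card F}"
      using F(2) by (auto simp: image_iff)
    also have "the ` \<dots> = F" using e by (simp add: image_image bij_betw_def)
    finally have "the ` (?g ` {..<f} - {None}) = F" .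
    moreover have "?g \<in> {..<f} \<rightarrow>\<^sub>E (insert None (Some ` A))"
      using e F(1) by (auto simp: bij_betw_def PiE_iff)
    ultimately show "F \<in> (\<lambda>g. the ` (g ` {..<f} - {None})) ` ({..<f} \<rightarrow>\<^sub>E (insert None (Some ` A)))"
      by (metis (lifting) image_eqI)
  qed
  then have "card {F. F \<subseteq> A \<and> card F \<le> f} \<le> card ({..<f} \<rightarrow>\<^sub>E (insert None (Some ` A)))"
    using assms by (intro surj_card_le finite_PiE) auto
  also have "\<dots> = (card A + 1) ^ f"
    using assms by (simp add: card_PiE card_image)
  finally show ?thesis .
qed

section \<open>The covering given by a sequence of colourings\<close>

text \<open>The chaining of arcs and the visited vertices depend only on the list, so the edge set
  enters through the inclusion alone. This allows a path to be moved between subgraphs.\<close>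

lemma path_in_iff:
  "path_in (spanning_sub G A) s p t \<longleftrightarrow>
     s < nverts G \<and> set p \<subseteq> (if directed G then A else A \<union> A\<inverse>) \<and>
     pre_digraph.cas (with_proj (spanning_sub G {})) s p t \<and>
     distinct (pre_digraph.awalk_verts (with_proj (spanning_sub G {})) s p)"
proof -
  have cas: "pre_digraph.cas (with_proj D) s p t = pre_digraph.cas (with_proj D') s p t"
    for D D' :: "nat pair_pre_digraph"
    by (induction p arbitrary: s) (auto simp: pre_digraph.cas.simps)
  have verts: "pre_digraph.awalk_verts (with_proj D) s p = pre_digraph.awalk_verts (with_proj D') s p"
    for D D' :: "nat pair_pre_digraph"
    by (simp add: pre_digraph.awalk_verts_conv)
  show ?thesis
    unfolding path_in_def pre_digraph.apath_def pre_digraph.awalk_def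
    using cas[of "spanning_sub G A" "spanning_sub G {}"] verts[of "spanning_sub G A" "spanning_sub G {}"]
    by (auto simp: spanning_sub_def)
qed

text \<open>Reduces retaining a path to containing a set of edges that is small enough for the
  colouring argument.\<close>

lemma path_edges:
  assumes wf: "wf_wgraph G" and A: "A \<subseteq> edges G" and p: "path_in (spanning_sub G A) s p t"
  obtains P where "P \<subseteq> A" "card P \<le> length p" "card P \<le> nverts G"
    "\<And>H. P \<subseteq> H \<Longrightarrow> path_in (spanning_sub G H) s p t"
proof
  \<comment> \<open>An arc of an undirected graph is traced back to the ordered pair that represents
    its edge.\<close>
  let ?e = "\<lambda>(u, v). if directed G then (u, v) else (min u v, max u v)"
  let ?P = "?e ` set p"
  have arcs: "set p \<subseteq> (if directed G then A else A \<union> A\<inverse>)" using p by (simp add: path_in_iff)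
  have wfA: "u < nverts G \<and> v < nverts G \<and> (\<not> directed G \<longrightarrow> u < v)" if "(u, v) \<in> A" for u v
    using wf A that unfolding wf_wgraph_def by blast
  show "?P \<subseteq> A"
  proof
    fix a assume "a \<in> ?P"
    then obtain u v where uv: "(u, v) \<in> set p" "a = ?e (u, v)" by auto
    then show "a \<in> A" using arcs wfA[of u v] wfA[of v u]
      by (auto simp: min_def max_def split: if_splits)
  qed
  show le: "card ?P \<le> length p" using card_image_le[of "set p" ?e] card_length[of p] by simp
  have "length p \<le> nverts G"
  proof (cases "p = []")
    case False
    \<comment> \<open>The tails of the arcs of a simple path are distinct vertices, which bounds its
      length by \<open>n\<close>.\<close>
    then have "distinct (map fst p)"
      using p by (simp add: path_in_iff pre_digraph.awalk_verts_conv)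
    then have "length p = card (set (map fst p))" using distinct_card by fastforce
    also have "\<dots> \<le> card {..<nverts G}"
      using arcs wfA by (intro card_mono) (auto split: if_splits)
    finally show ?thesis by simp
  qed simp
  then show "card ?P \<le> nverts G" using le by simp
  show "path_in (spanning_sub G H) s p t" if H: "?P \<subseteq> H" for H
  proof -
    have "a \<in> (if directed G then H else H \<union> H\<inverse>)" if "a \<in> set p" for a
    proof -
      have "?e a \<in> H" using H that by blast
      then show ?thesis by (cases a) (auto simp: min_def max_def split: if_splits)
    qed
    then show ?thesis using p unfolding path_in_iff by blast
  qed
qed

text \<open>The position of the pair in a row-major adjacency matrix; it also orders the edges for
  the ranks.\<close>

definition edge_key :: "nat \<Rightarrow> nat \<times> nat \<Rightarrow> nat" where
  "edge_key n = (\<lambda>(u, v). u * n + v)"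

lemma edge_key_less: "u < n \<Longrightarrow> v < n \<Longrightarrow> edge_key n (u, v) < n * n"
proof -
  assume uv: "u < n" "v < n"
  have "Suc u * n \<le> n * n" using uv by (intro mult_right_mono) auto
  then show ?thesis using uv by (simp add: edge_key_def)
qed

lemma inj_edge_key: "inj_on (edge_key n) ({..<n} \<times> {..<n})"
proof (rule inj_onI, clarsimp simp: edge_key_def)
  fix u v u' v' assume "u * n + v = u' * n + v'" "v < n" "v' < n"
  then show "u = u' \<and> v = v'"
    by (metis add_right_cancel add.commute div_mult_self3 div_less add_0 gr_zeroI not_less0 mod_less mod_mult_self3)
qed

lemma edges_subset: "wf_wgraph G \<Longrightarrow> edges G \<subseteq> {..<nverts G} \<times> {..<nverts G}"
  by (auto simp: wf_wgraph_def)

lemma finite_edges: "wf_wgraph G \<Longrightarrow> finite (edges G)"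
  by (rule finite_subset[OF edges_subset]) simp_all

lemma card_edges_le: "wf_wgraph G \<Longrightarrow> card (edges G) \<le> nverts G * nverts G"
  using card_mono[OF _ edges_subset] by (simp add: card_cartesian_product)

section \<open>Existence of colourings that serve all failure sets\<close>

text \<open>The averaging argument is applied to the triples \<open>(F, s, t)\<close> with
  \<open>D = 4 ^ f\<close>; there are fewer than \<open>2 ^ ((f + 1) * \<beta>)\<close> of
  them.\<close>

lemma colourings_exist:
  assumes wf: "wf_wgraph G" and L: "1 \<le> L" and \<beta>: "nverts G * nverts G + 2 \<le> 2 ^ \<beta>"
  shows "\<exists>hs. (\<forall>r. hs r \<in> edges G \<rightarrow>\<^sub>E {..<2 ^ colour_bits L (nverts G)}) \<and>
    (\<forall>F s t. F \<subseteq> edges G \<and> card F \<le> f \<and> s < nverts G \<and> t < nverts G \<and>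
      (\<exists>p. shortest_path (spanning_sub G (edges G - F)) (arc_weight G) s p t \<and> length p \<le> L) \<longrightarrow>
      (\<exists>r<4 ^ f * ((f + 1) * \<beta>). \<exists>P p. P \<subseteq> edges G \<and> separates f (hs r) F P \<and>
        shortest_path (spanning_sub G (edges G - F)) (arc_weight G) s p t \<and> length p \<le> L \<and>
        (\<forall>H. P \<subseteq> H \<longrightarrow> path_in (spanning_sub G H) s p t)))"
proof -
  let ?n = "nverts G" and ?E = "edges G"
  let ?short = "\<lambda>F s p t. shortest_path (spanning_sub G (?E - F)) (arc_weight G) s p t \<and> length p \<le> L"
  let ?\<Omega> = "?E \<rightarrow>\<^sub>E {..<(2::nat) ^ colour_bits L ?n}"
  define C where "C = {(F, s, t). F \<subseteq> ?E \<and> card F \<le> f \<and> s < ?n \<and> t < ?n \<and> (\<exists>p. ?short F s p t)}"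
  define valid where "valid = (\<lambda>(F, s, t) P. P \<subseteq> ?E - F \<and> card P \<le> min L ?n \<and>
      (\<exists>p. ?short F s p t \<and> (\<forall>H. P \<subseteq> H \<longrightarrow> path_in (spanning_sub G H) s p t)))"
  have "\<exists>P. valid c P" if c: "c \<in> C" for c
  proof (cases c)
    case (fields F s t)
    then obtain p where p: "?short F s p t" using c by (auto simp: C_def)
    then have "path_in (spanning_sub G (?E - F)) s p t" by (simp add: shortest_path_def)
    then obtain P where P: "P \<subseteq> ?E - F" "card P \<le> length p" "card P \<le> ?n"
      "\<And>H. P \<subseteq> H \<Longrightarrow> path_in (spanning_sub G H) s p t"
      using path_edges[OF wf, of "?E - F" s p t] by blast
    then have "valid c P" using p by (auto simp: fields valid_def)
    then show ?thesis ..
  qed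
  \<comment> \<open>One edge set is fixed per triple beforehand, so that serving the triple becomes
    a single separation event.\<close>
  then have "\<exists>P. \<forall>c\<in>C. valid c (P c)" by (intro bchoice) blast
  then obtain P where valid: "\<And>c. c \<in> C \<Longrightarrow> valid c (P c)" by blast
  have P: "P (F, s, t) \<subseteq> ?E - F" "card (P (F, s, t)) \<le> min L ?n"
    "\<exists>p. ?short F s p t \<and> (\<forall>H. P (F, s, t) \<subseteq> H \<longrightarrow> path_in (spanning_sub G H) s p t)"
    if "(F, s, t) \<in> C" for F s t
    using valid[OF that] by (simp_all add: valid_def)
  note finE = finite_edges[OF wf]
  have Csub: "C \<subseteq> {F. F \<subseteq> ?E \<and> card F \<le> f} \<times> ({..<?n} \<times> {..<?n})" by (auto simp: C_def)
  have finS: "finite {F. F \<subseteq> ?E \<and> card F \<le> f}" using finE by simp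
  then have finC: "finite C" using finite_subset[OF Csub] by simp
  have "card C \<le> card ({F. F \<subseteq> ?E \<and> card F \<le> f} \<times> ({..<?n} \<times> {..<?n}))"
    using finS by (intro card_mono Csub) simp
  also have "\<dots> = card {F. F \<subseteq> ?E \<and> card F \<le> f} * (?n * ?n)" by (simp add: card_cartesian_product)
  also have "\<dots> \<le> (card ?E + 1) ^ f * (?n * ?n)" using card_subsets_le[OF finE] by (intro mult_right_mono) auto
  \<comment> \<open>Each of the \<open>f\<close> places in a listing of a failure set has at most
    \<open>2 ^ \<beta>\<close> choices, and the pair of end vertices accounts for one more factor of
    this size.\<close>
  also have "\<dots> \<le> (2 ^ \<beta>) ^ f * (?n * ?n)"
    using card_edges_le[OF wf] \<beta> by (intro mult_right_mono power_mono) auto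
  also have "\<dots> < (2 ^ \<beta>) ^ f * 2 ^ \<beta>" using \<beta> by (intro mult_strict_left_mono) auto
  also have "\<dots> = 2 ^ ((f + 1) * \<beta>)" by (simp add: power_mult[symmetric] power_add[symmetric] algebra_simps)
  finally have cardC: "card C < 2 ^ ((f + 1) * \<beta>)" .
  define good where "good = (\<lambda>h (F, s, t). separates f h F (P (F, s, t)))"
  have enough: "card ?\<Omega> \<le> 4 ^ f * card {h \<in> ?\<Omega>. good h c}" if c: "c \<in> C" for c
  proof (cases c)
    case (fields F s t)
    with c have FC: "(F, s, t) \<in> C" by simp
    then have F: "F \<subseteq> ?E" "card F \<le> f" "0 < ?n" by (auto simp: C_def)
    \<comment> \<open>Positive \<open>L\<close> and \<open>n\<close> force at least two colours, so
      the palette has size \<open>2 * 2 ^ b\<close>, with \<open>2 ^ b\<close> in the role of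
      \<open>a\<close> in \<open>card_separating\<close>.\<close>
    have "2 * 1 \<le> 2 * min L ?n" using L F(3) by simp
    also have "\<dots> \<le> 2 ^ colour_bits L ?n" by (rule colour_bits_ge)
    finally obtain b where b: "colour_bits L ?n = Suc b" by (cases "colour_bits L ?n") auto
    have "min L ?n \<le> 2 ^ b" using colour_bits_ge[of L ?n] b by simp
    with P(2)[OF FC] have Pa: "card (P (F, s, t)) \<le> 2 ^ b" by (rule order_trans)
    have "card (?E \<rightarrow>\<^sub>E {..<2 * (2::nat) ^ b}) \<le>
        4 ^ f * card {h \<in> ?E \<rightarrow>\<^sub>E {..<2 * 2 ^ b}. separates f h F (P (F, s, t))}"
      using P(1)[OF FC] F by (intro card_separating finE Pa) auto
    then show ?thesis by (simp add: b fields good_def)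
  qed
  have ne: "?\<Omega> \<noteq> {}" by (simp add: PiE_eq_empty_iff lessThan_empty_iff)
  have fin: "finite ?\<Omega>" using finE by (simp add: finite_PiE)
  have "\<exists>hs. (\<forall>r. hs r \<in> ?\<Omega>) \<and> (\<forall>c\<in>C. \<exists>r<4 ^ f * ((f + 1) * \<beta>). good (hs r) c)"
    by (rule covering_sequence_exists[OF fin ne finC _ cardC enough]) simp_all
  then obtain hs where hs: "\<forall>r. hs r \<in> ?\<Omega>" "\<forall>c\<in>C. \<exists>r<4 ^ f * ((f + 1) * \<beta>). good (hs r) c"
    by blast
  show ?thesis
  proof (rule exI[of _ hs], rule conjI[OF hs(1)], intro allI impI)
    fix F s t
    assume "F \<subseteq> ?E \<and> card F \<le> f \<and> s < ?n \<and> t < ?n \<and> (\<exists>p. ?short F s p t)"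
    then have FC: "(F, s, t) \<in> C" by (simp add: C_def)
    then obtain r where r: "r < 4 ^ f * ((f + 1) * \<beta>)" "separates f (hs r) F (P (F, s, t))"
      using bspec[OF hs(2) FC] by (auto simp: good_def)
    show "\<exists>r<4 ^ f * ((f + 1) * \<beta>). \<exists>P p. P \<subseteq> ?E \<and> separates f (hs r) F P \<and>
        shortest_path (spanning_sub G (?E - F)) (arc_weight G) s p t \<and> length p \<le> L \<and>
        (\<forall>H. P \<subseteq> H \<longrightarrow> path_in (spanning_sub G H) s p t)"
      using r P(1)[OF FC] P(3)[OF FC] by (intro exI[of _ r] conjI exI[of _ "P (F, s, t)"]) blast+
  qed
qed

section \<open>The family of subgraphs and the members selected for a failure set\<close>

definition block_size :: "nat \<Rightarrow> nat \<Rightarrow> nat \<Rightarrow> nat" where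
  "block_size L n f = (2 ^ colour_bits L n) ^ f + colour_bits L n"

text \<open>
  Block \<open>r\<close> holds, for each code of at most \<open>f\<close> colours, the graph without the edges of these
  colours, followed by one graph per bit position from which a query can read off the colours
  assigned by \<open>hs r\<close>.
\<close>

definition colour_family :: "wgraph \<Rightarrow> nat \<Rightarrow> nat \<Rightarrow> (nat \<Rightarrow> nat \<times> nat \<Rightarrow> nat) \<Rightarrow> nat \<Rightarrow> (nat \<times> nat) set" where
  "colour_family G L f hs i =
     (let q = 2 ^ colour_bits L (nverts G);
          M = block_size L (nverts G) f; r = i div M; x = i mod M
      in {e \<in> edges G. if x < q ^ f then hs r e \<notin> digits q f x
                       else odd (hs r e div 2 ^ (x - q ^ f))})"

definition colour_selection :: "wgraph \<Rightarrow> nat \<Rightarrow> nat \<Rightarrow> nat \<Rightarrow> (nat \<Rightarrow> nat \<times> nat \<Rightarrow> nat) \<Rightarrow>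
    (nat \<times> nat) set \<Rightarrow> nat set" where
  "colour_selection G L f R hs F =
     (\<lambda>r. r * block_size L (nverts G) f +
        colour_code (edge_key (nverts G)) (2 ^ colour_bits L (nverts G)) (hs r) F) ` {..<R}"

lemma card_colour_selection_le: "card (colour_selection G L f R hs F) \<le> R"
  unfolding colour_selection_def by (rule card_image_le[THEN order_trans]) simp_all

lemma colour_family_block:
  fixes G f L
  defines "n \<equiv> nverts G"
  defines "q \<equiv> 2 ^ colour_bits L n"
  defines "M \<equiv> block_size L n f"
  shows "x < q ^ f \<Longrightarrow> colour_family G L f hs (r * M + x) = {e \<in> edges G. hs r e \<notin> digits q f x}"
    and "j < colour_bits L n \<Longrightarrow>
      colour_family G L f hs (r * M + q ^ f + j) = {e \<in> edges G. odd (hs r e div 2 ^ j)}"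
proof -
  have M: "M = q ^ f + colour_bits L n" by (simp add: M_def block_size_def q_def)
  show "colour_family G L f hs (r * M + x) = {e \<in> edges G. hs r e \<notin> digits q f x}" if "x < q ^ f"
  proof -
    have "x < M" using that M by simp
    then have "(r * M + x) div M = r" "(r * M + x) mod M = x" by simp_all
    then show ?thesis using that
      by (simp add: colour_family_def Let_def flip: n_def q_def M_def)
  qed
  show "colour_family G L f hs (r * M + q ^ f + j) = {e \<in> edges G. odd (hs r e div 2 ^ j)}"
    if "j < colour_bits L n"
  proof -
    have "q ^ f + j < M" using that M by simp
    then have "(r * M + (q ^ f + j)) div M = r" "(r * M + (q ^ f + j)) mod M = q ^ f + j" by simp_all
    then show ?thesis
      by (simp add: colour_family_def Let_def add.assoc flip: n_def q_def M_def)
  qed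
qed

context
  fixes G :: wgraph and L f R :: nat and hs :: "nat \<Rightarrow> nat \<times> nat \<Rightarrow> nat"
  assumes wf: "wf_wgraph G"
    and hs: "\<And>r. hs r \<in> edges G \<rightarrow>\<^sub>E {..<2 ^ colour_bits L (nverts G)}"
begin

lemma colour_code_facts:
  fixes F
  defines "n \<equiv> nverts G"
  defines "q \<equiv> 2 ^ colour_bits L n"
  assumes F: "F \<subseteq> edges G" "card F \<le> f"
  shows "colour_code (edge_key n) q (hs r) F < q ^ f"
    and "digits q f (colour_code (edge_key n) q (hs r) F) = hs r ` F \<union> (if card F < f then {0} else {})"
proof -
  have fin: "finite F" using F finite_edges[OF wf] finite_subset by blast
  have inj: "inj_on (edge_key n) F"
    using inj_on_subset[OF inj_edge_key[of n]] F edges_subset[OF wf] unfolding n_def by blast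
  have h: "hs r e < q" if "e \<in> F" for e
    using hs[of r] that F by (auto simp: PiE_iff q_def n_def)
  show "colour_code (edge_key n) q (hs r) F < q ^ f"
    by (rule colour_code_less[OF fin inj F(2) h]) (auto simp: q_def)
  show "digits q f (colour_code (edge_key n) q (hs r) F) = hs r ` F \<union> (if card F < f then {0} else {})"
    by (rule digits_colour_code[OF fin inj F(2) h]) (auto simp: q_def)
qed

lemma colour_covering:
  assumes cover: "\<And>F s t. F \<subseteq> edges G \<Longrightarrow> card F \<le> f \<Longrightarrow> s < nverts G \<Longrightarrow> t < nverts G \<Longrightarrow>
      \<exists>p. shortest_path (spanning_sub G (edges G - F)) (arc_weight G) s p t \<and> length p \<le> L \<Longrightarrow>
      \<exists>r<R. \<exists>P p. P \<subseteq> edges G \<and> separates f (hs r) F P \<and>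
        shortest_path (spanning_sub G (edges G - F)) (arc_weight G) s p t \<and> length p \<le> L \<and>
        (\<forall>H. P \<subseteq> H \<longrightarrow> path_in (spanning_sub G H) s p t)"
  shows "replacement_path_covering G L f (R * block_size L (nverts G) f)
    (colour_family G L f hs) (colour_selection G L f R hs)"
proof -
  let ?n = "nverts G" and ?E = "edges G" and ?H = "colour_family G L f hs"
  let ?q = "2 ^ colour_bits L ?n :: nat"
  let ?M = "block_size L ?n f"
  let ?code = "\<lambda>r. colour_code (edge_key ?n) ?q (hs r)"
  have main: "colour_selection G L f R hs F \<subseteq> {..<R * ?M} \<and>
        (\<forall>i \<in> colour_selection G L f R hs F. ?H i \<inter> F = {}) \<and>
        (\<forall>s<?n. \<forall>t<?n.
           (\<exists>p. shortest_path (spanning_sub G (?E - F)) (arc_weight G) s p t \<and> length p \<le> L) \<longrightarrow>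
           (\<exists>i \<in> colour_selection G L f R hs F.
              \<exists>p. shortest_path (spanning_sub G (?E - F)) (arc_weight G) s p t \<and>
              length p \<le> L \<and> path_in (spanning_sub G (?H i)) s p t))"
    if F: "F \<subseteq> ?E" "card F \<le> f" for F
  proof (intro conjI allI ballI impI)
    note code_less = colour_code_facts(1)[OF F] and code_digits = colour_code_facts(2)[OF F]
    \<comment> \<open>The selected member of block \<open>r\<close> lacks exactly the colours of
      \<open>F\<close>, and colour 0 if the code is padded. So it misses \<open>F\<close>, and it
      contains every \<open>P\<close> that \<open>hs r\<close> separates from
      \<open>F\<close>.\<close>
    have H: "?H (r * ?M + ?code r F) = {e \<in> ?E. hs r e \<notin> hs r ` F \<union> (if card F < f then {0} else {})}" for r
      unfolding colour_family_block(1)[OF code_less] code_digits ..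
    show "colour_selection G L f R hs F \<subseteq> {..<R * ?M}"
    proof
      fix i assume "i \<in> colour_selection G L f R hs F"
      then obtain r where r: "r < R" "i = r * ?M + ?code r F" by (auto simp: colour_selection_def)
      have "?code r F < ?M" using code_less[of r] by (simp add: block_size_def)
      then have "i < Suc r * ?M" using r by simp
      also have "\<dots> \<le> R * ?M" using r(1) by (intro mult_right_mono) auto
      finally show "i \<in> {..<R * ?M}" by simp
    qed
    show "?H i \<inter> F = {}" if "i \<in> colour_selection G L f R hs F" for i
      using that H by (auto simp: colour_selection_def)
    fix s t assume "s < ?n" "t < ?n"
      "\<exists>p. shortest_path (spanning_sub G (?E - F)) (arc_weight G) s p t \<and> length p \<le> L"
    from cover[OF F this] obtain r P p where r: "r < R" and P: "P \<subseteq> ?E" "separates f (hs r) F P"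
      and p: "shortest_path (spanning_sub G (?E - F)) (arc_weight G) s p t" "length p \<le> L"
        "\<forall>H. P \<subseteq> H \<longrightarrow> path_in (spanning_sub G H) s p t"
      by blast
    have "P \<subseteq> ?H (r * ?M + ?code r F)" using P unfolding H separates_def by blast
    moreover have "r * ?M + ?code r F \<in> colour_selection G L f R hs F"
      using r by (simp add: colour_selection_def)
    ultimately show "\<exists>i \<in> colour_selection G L f R hs F.
        \<exists>p. shortest_path (spanning_sub G (?E - F)) (arc_weight G) s p t \<and>
          length p \<le> L \<and> path_in (spanning_sub G (?H i)) s p t"
      using p by blast
  qed
  have "?H i \<subseteq> ?E" for i by (auto simp: colour_family_def Let_def)
  then show ?thesis
    unfolding replacement_path_covering_def
    by (rule conjI[OF allI[OF impI]]) (intro allI impI, rule main, simp_all)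
qed

end

section \<open>Answering queries\<close>

lemma nth_concat_uniform:
  assumes "\<forall>x\<in>set xss. length x = d" "i < length xss" "j < d"
  shows "concat xss ! (i * d + j) = xss ! i ! j"
  using assms
proof (induction xss arbitrary: i)
  case (Cons x xss)
  then show ?case
    by (cases i) (auto simp: nth_append)
qed simp

lemma length_concat_uniform:
  "\<forall>x\<in>set xss. length x = d \<Longrightarrow> length (concat xss) = length xss * d"
  by (induction xss) auto

lemma length_adjacency_words [simp]: "length (adjacency_words n A) = n * n"
  unfolding adjacency_words_def by (subst length_concat_uniform[where d = n]) auto

lemma nth_adjacency_words:
  assumes "u < n" "v < n"
  shows "adjacency_words n A ! edge_key n (u, v) = of_bool ((u, v) \<in> A)"
  unfolding adjacency_words_def edge_key_def prod.case
  using assms by (subst nth_concat_uniform[where d = n]) auto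

lemma length_query_input:
  "length (query_input G L f K H Fs) =
     6 + 2 * length Fs + nverts G * nverts G + K * (nverts G * nverts G)"
proof -
  have "length (concat (map (\<lambda>(u, v). [u, v]) Fs)) = length Fs * 2"
    by (subst length_concat_uniform[where d = 2]) auto
  moreover have "length (concat (map (\<lambda>i. adjacency_words (nverts G) (H i)) [0..<K])) =
      K * (nverts G * nverts G)"
    by (subst length_concat_uniform[where d = "nverts G * nverts G"]) auto
  ultimately show ?thesis by (simp add: query_input_def)
qed

lemma nth_query_input_edge:
  assumes "i < length Fs"
  shows "query_input G L f K H Fs ! (6 + 2 * i) = fst (Fs ! i)"
    and "query_input G L f K H Fs ! (7 + 2 * i) = snd (Fs ! i)"
proof -
  let ?c = "concat (map (\<lambda>(u, v). [u, v]) Fs)"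
  have len: "length ?c = length Fs * 2"
    by (subst length_concat_uniform[where d = 2]) auto
  have "?c ! (i * 2 + j) = [fst (Fs ! i), snd (Fs ! i)] ! j" if "j < 2" for j
    using assms that by (subst nth_concat_uniform[where d = 2]) (auto simp: case_prod_unfold)
  from this[of 0] this[of 1]
  have c: "?c ! (2 * i) = fst (Fs ! i)" "?c ! Suc (2 * i) = snd (Fs ! i)"
    by (simp_all add: mult.commute)
  have "6 + 2 * i = Suc (Suc (Suc (Suc (Suc (Suc (2 * i))))))"
    "7 + 2 * i = Suc (Suc (Suc (Suc (Suc (Suc (Suc (2 * i)))))))" by simp_all
  then show "query_input G L f K H Fs ! (6 + 2 * i) = fst (Fs ! i)"
    and "query_input G L f K H Fs ! (7 + 2 * i) = snd (Fs ! i)"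
    using assms len c by (simp_all add: query_input_def nth_append)
qed

lemma nth_query_input_family:
  assumes "g < K" "u < nverts G" "v < nverts G"
  shows "query_input G L f K H Fs ! (6 + 2 * length Fs + nverts G * nverts G +
      g * (nverts G * nverts G) + edge_key (nverts G) (u, v)) = of_bool ((u, v) \<in> H g)"
proof -
  let ?n = "nverts G" and ?c = "concat (map (\<lambda>(u, v). [u, v]) Fs)"
  let ?h = "concat (map (\<lambda>i. adjacency_words (nverts G) (H i)) [0..<K])"
  let ?pre = "[?n, of_bool (directed G), L, f, K, length Fs] @ ?c @ adjacency_words ?n (edges G)"
  have key: "edge_key ?n (u, v) < ?n * ?n" using assms edge_key_less by simp
  have "length ?c = length Fs * 2" by (subst length_concat_uniform[where d = 2]) auto
  then have len: "length ?pre = 6 + 2 * length Fs + ?n * ?n" by simp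
  have "query_input G L f K H Fs = ?pre @ ?h" by (simp add: query_input_def)
  then have "query_input G L f K H Fs ! (length ?pre + (g * (?n * ?n) + edge_key ?n (u, v))) =
      ?h ! (g * (?n * ?n) + edge_key ?n (u, v))"
    by (simp only: nth_append_length_plus)
  also have "\<dots> = adjacency_words ?n (H g) ! edge_key ?n (u, v)"
    using assms key by (subst nth_concat_uniform[where d = "?n * ?n"]) auto
  also have "\<dots> = of_bool ((u, v) \<in> H g)" using assms by (intro nth_adjacency_words)
  finally show ?thesis unfolding len by (simp only: add.assoc)
qed

text \<open>A word length with factor \<open>c\<close> accommodates \<open>c\<close>-th powers of
  the input length plus its largest entry. The query program needs room for
  \<open>4 * X * X\<close>, for which \<open>c = 4\<close> suffices.\<close>

lemma power_word_length_ge: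
  assumes "xs \<noteq> []"
  shows "(length xs + Max (set xs) + 2) ^ c \<le> 2 ^ word_length c xs"
proof -
  let ?X = "length xs + Max (set xs) + 2"
  let ?l = "nat \<lceil>log 2 (real ?X)\<rceil>"
  have "real ?X = 2 powr log 2 (real ?X)" by simp
  also have "\<dots> \<le> 2 powr real ?l" by (intro powr_mono) (auto simp: real_nat_ceiling_ge)
  also have "\<dots> = real (2 ^ ?l)" unfolding of_nat_power by (subst powr_realpow) simp_all
  finally have "?X \<le> 2 ^ ?l" by (simp only: of_nat_le_iff)
  then have "?X ^ c \<le> (2 ^ ?l) ^ c" by (intro power_mono) auto
  then show ?thesis by (simp add: word_length_def power_mult[symmetric] mult.commute)
qed

text \<open>The program sums over list positions; as ranks are taken by key, the result depends only
  on the set.\<close>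

lemma colour_code_nth:
  assumes "distinct Fs"
  shows "(\<Sum>i<length Fs. h (Fs ! i) * q ^ card {j. j < length Fs \<and> key (Fs ! j) < key (Fs ! i)})
    = colour_code key q h (set Fs)"
proof -
  have bij: "bij_betw ((!) Fs) {..<length Fs} (set Fs)"
    using assms by (rule bij_betw_nth) auto
  have "card {j. j < length Fs \<and> key (Fs ! j) < key (Fs ! i)} = rank_in key (set Fs) (Fs ! i)" for i
  proof -
    have img: "(!) Fs ` {j. j < length Fs \<and> key (Fs ! j) < key (Fs ! i)} =
        {e \<in> set Fs. key e < key (Fs ! i)}"
      by (auto simp: in_set_conv_nth)
    have inj: "inj_on ((!) Fs) {j. j < length Fs \<and> key (Fs ! j) < key (Fs ! i)}"
      using bij by (auto simp: bij_betw_def intro: inj_on_subset)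
    show ?thesis unfolding rank_in_def img[symmetric] by (rule card_image[OF inj, symmetric])
  qed
  then show ?thesis
    unfolding colour_code_def
    using sum.reindex_bij_betw[OF bij, of "\<lambda>e. h e * q ^ rank_in key (set Fs) e"] by simp
qed

section \<open>The query program on the actual input\<close>

definition query_steps :: "nat \<Rightarrow> nat \<Rightarrow> nat \<Rightarrow> nat \<Rightarrow> nat" where
  "query_steps f k R b = R * (k * (k * 13 + b * 11 + 18) + 9) + b * 7 + f * 4 + 30"

lemma query_prog_correct:
  assumes wf: "wf_wgraph G"
    and hs: "\<And>r. hs r \<in> edges G \<rightarrow>\<^sub>E {..<2 ^ colour_bits L (nverts G)}"
    and f: "1 \<le> f" and R: "1 \<le> R"
    and Fs: "distinct Fs" "set Fs \<subseteq> edges G" "length Fs \<le> f"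
  defines "xs \<equiv> query_input G L f (R * block_size L (nverts G) f) (colour_family G L f hs) Fs"
  shows "\<exists>ys. distinct ys \<and> set ys = colour_selection G L f R hs (set Fs) \<and>
    ram_computes (word_length 4 xs) (compile 0 query_prog) xs
      (query_steps f (length Fs) R (colour_bits L (nverts G))) ys"
proof -
  let ?n = "nverts G" and ?k = "length Fs" and ?M = "block_size L (nverts G) f"
  let ?b = "colour_bits L (nverts G)"
  let ?H = "colour_family G L f hs"
  let ?w = "word_length 4 xs"
  let ?key = "\<lambda>i. edge_key ?n (Fs ! i)" and ?col = "\<lambda>r i. hs r (Fs ! i)"
  let ?code = "\<lambda>r. colour_code (edge_key ?n) (2 ^ ?b) (hs r) (set Fs)"
  define X where "X = length xs + Max (set xs) + 2"
  define m where "m = mem (ram_init xs)"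
  have m: "m a = xs ! a" if "a < length xs" for a using that by (simp add: m_def ram_init_def)
  have len: "length xs = 6 + 2 * ?k + ?n * ?n + R * ?M * (?n * ?n)"
    unfolding xs_def by (rule length_query_input)
  have heads: "xs ! 0 = ?n" "xs ! 2 = L" "xs ! 3 = f" "xs ! 4 = R * ?M" "xs ! 5 = ?k"
    by (simp_all add: xs_def query_input_def)
  have Max: "xs ! a < X" if "a < length xs" for a
  proof -
    have "xs ! a \<le> Max (set xs)" using that by (intro Max_ge) auto
    then show ?thesis by (simp add: X_def)
  qed
  have X4: "4 * X * X < 2 ^ ?w"
  proof -
    \<comment> \<open>The six header cells and the summand 2 give \<open>8 \<le> X\<close>, which
      puts \<open>4 * X * X\<close> below \<open>X ^ 4\<close>.\<close>
    have X8: "8 \<le> X" using len by (simp add: X_def)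
    then have "4 * (X * X) < (8 * 8) * (X * X)" by simp
    also have "\<dots> \<le> (X * X) * (X * X)" using X8 by (intro mult_right_mono mult_mono) auto
    also have "\<dots> = X ^ 4" by (simp add: power4_eq_xxxx)
    also have "\<dots> \<le> 2 ^ ?w" unfolding X_def using len by (intro power_word_length_ge) auto
    finally show ?thesis by simp
  qed
  have edge: "fst (Fs ! i) < ?n" "snd (Fs ! i) < ?n" "Fs ! i \<in> edges G" if "i < ?k" for i
  proof -
    show "Fs ! i \<in> edges G" using nth_mem[OF that] Fs(2) by (rule rev_subsetD)
    then have "Fs ! i \<in> {..<?n} \<times> {..<?n}" using edges_subset[OF wf] by (rule rev_subsetD)
    then show "fst (Fs ! i) < ?n" "snd (Fs ! i) < ?n" by (simp_all add: mem_Times_iff)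
  qed
  have key: "?key i < ?n * ?n" if "i < ?k" for i
    using edge_key_less[OF edge(1,2)[OF that]] by simp
  have card: "card (set Fs) \<le> f" using Fs(3) card_length[of Fs] by simp
  have code_less: "?code r < (2 ^ ?b) ^ f" for r
    by (rule colour_code_facts(1)[OF wf hs Fs(2) card])
  \<comment> \<open>Index \<open>i\<close> stands for the \<open>i\<close>-th listed edge; what
    remains is to compare the memory with the layout of \<open>query_input\<close>.\<close>
  interpret colour_query ?w ?n L f ?k R X m ?key ?col ?b "(2 ^ ?b) ^ f + ?b"
    "\<lambda>r. \<Sum>i<?k. ?col r i * (2 ^ ?b) ^ card {j. j < ?k \<and> ?key j < ?key i}"
  proof (unfold_locales; (fold block_size_def)?)
    show "6 + 2 * ?k + ?n * ?n + R * ?M * (?n * ?n) < X" using len by (simp add: X_def)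
    show "L < X" "f < X" "?n < X" "R * ?M < X" using Max[of 2] Max[of 3] Max[of 0] Max[of 4] unfolding heads by (simp_all add: len)
    show "4 * X * X < 2 ^ ?w" by (rule X4)
    show "1 \<le> f" "?k \<le> f" "1 \<le> R" by fact+
    show "m 0 = ?n" "m 2 = L" "m 3 = f" "m 4 = R * ?M" "m 5 = ?k" using heads len m by simp_all
    show "m (6 + 2 * i) * ?n + m (7 + 2 * i) = ?key i" if "i < ?k" for i
      using that len nth_query_input_edge[OF that]
      by (simp add: m edge_key_def case_prod_unfold) (simp add: xs_def)
    show "?key i < ?n * ?n" if "i < ?k" for i by (rule key[OF that])
    show "m (6 + 2 * ?k + ?n * ?n + (r * ?M + (2 ^ ?b) ^ f + j) * (?n * ?n) + ?key i) =
        ?col r i div 2 ^ j mod 2" if r: "r < R" and j: "j < ?b" and i: "i < ?k" for r j i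
    proof -
      let ?g = "r * ?M + (2 ^ ?b) ^ f + j"
      have "?g < Suc r * ?M" using j by (simp add: block_size_def)
      also have "\<dots> \<le> R * ?M" using r by (intro mult_right_mono) auto
      finally have g: "?g < R * ?M" .
      then have "Suc ?g * (?n * ?n) \<le> R * ?M * (?n * ?n)" by (intro mult_right_mono) auto
      then have "6 + 2 * ?k + ?n * ?n + ?g * (?n * ?n) + ?key i < length xs"
        using key[OF i] unfolding len by simp
      \<comment> \<open>The matrix entry of the failed edge in bit graph \<open>j\<close> of block
        \<open>r\<close> is bit \<open>j\<close> of its colour.\<close>
      then have "m (6 + 2 * ?k + ?n * ?n + ?g * (?n * ?n) + ?key i) = of_bool (Fs ! i \<in> ?H ?g)"
        using nth_query_input_family[OF g edge(1,2)[OF i], of L f ?H Fs]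
        by (simp only: m xs_def prod.collapse)
      also have "\<dots> = of_bool (odd (?col r i div 2 ^ j))"
        unfolding colour_family_block(2)[OF j] using edge(3)[OF i] by simp
      finally show ?thesis by (simp add: mod_2_eq_odd)
    qed
    show "?col r i < 2 ^ ?b" if "r < R" "i < ?k" for r i
      using hs[of r] edge(3)[OF that(2)] by (auto simp: PiE_iff)
    show "(\<Sum>i<?k. ?col r i * (2 ^ ?b) ^ card {j. j < ?k \<and> ?key j < ?key i}) < (2 ^ ?b) ^ f"
      if "r < R" for r
      unfolding colour_code_nth[OF Fs(1)] by (rule code_less)
  qed
  let ?ys = "map (\<lambda>r. r * ?M + ?code r) [0..<R]"
  have "ram_computes ?w (compile 0 query_prog) xs (query_steps f ?k R ?b) ?ys"
  proof (rule triple_ram_computes)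
    show "triple ?w ((=) (ram_init xs)) query_prog (query_steps f ?k R ?b) (\<lambda>s. emitted s = ?ys)"
      using triple_query_prog[of "ram_init xs"]
      unfolding colour_code_nth[OF Fs(1)] query_steps_def block_size_def
      by (simp add: m_def ram_init_def)
  qed
  moreover have "set ?ys = colour_selection G L f R hs (set Fs)"
    by (simp add: colour_selection_def atLeast0LessThan)
  moreover have "distinct ?ys"
  proof -
    \<comment> \<open>The block number recovers \<open>r\<close>, so different colourings give
      different indices.\<close>
    have "(r * ?M + ?code r) div ?M = r" for r
      using code_less[of r] by (simp add: block_size_def)
    then have "inj_on (\<lambda>r. r * ?M + ?code r) {0..<R}"
      by (intro inj_on_inverseI[where g = "\<lambda>i. i div ?M"])
    then show ?thesis by (simp add: distinct_map)
  qed
  ultimately show ?thesis by blast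
qed

section \<open>Parameters and asymptotics\<close>

text \<open>Serves as the exponent \<open>\<beta>\<close> of
  \<open>colourings_exist\<close>.\<close>

definition log_bound :: "nat \<Rightarrow> nat" where
  "log_bound n = nat \<lceil>log 2 (real (n * n + 2))\<rceil>"

lemma log_bound_ge: "n * n + 2 \<le> 2 ^ log_bound n"
proof -
  have "0 < n * n + 2" by simp
  then have pos: "0 < real (n * n + 2)" by (simp only: of_nat_0_less_iff)
  have "real (n * n + 2) = 2 powr log 2 (real (n * n + 2))"
    by (intro powr_log_cancel[symmetric] pos) simp_all
  also have "\<dots> \<le> 2 powr real (log_bound n)"
    unfolding log_bound_def by (intro powr_mono) (auto simp: real_nat_ceiling_ge)
  also have "\<dots> = real (2 ^ log_bound n)" unfolding of_nat_power by (subst powr_realpow) simp_all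
  finally show ?thesis by (simp only: of_nat_le_iff)
qed

lemma log_bound_pos: "1 \<le> log_bound n"
  using log_bound_ge[of n] by (cases "log_bound n") auto

lemma log_bound_le_ln:
  assumes "2 \<le> n"
  shows "real (log_bound n) \<le> 4 / ln 2 * ln (real n)"
proof -
  \<comment> \<open>For \<open>n \<ge> 2\<close> the argument of the logarithm is at most
    \<open>n ^ 3\<close>; rounding up adds 1, which is at most \<open>log 2 n\<close>. This gives
    the factor 3 + 1 = 4.\<close>
  have "n * n + 2 \<le> n * n * n"
  proof -
    have "2 * 2 \<le> n * n" using assms by (intro mult_mono) auto
    moreover have "n * n * 2 \<le> n * n * n" using assms by (intro mult_left_mono) auto
    ultimately show ?thesis by linarith
  qed
  then have "real (n * n + 2) \<le> real (n * n * n)" by (simp only: of_nat_le_iff)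
  then have "log 2 (real (n * n + 2)) \<le> log 2 (real (n * n * n))"
    using assms by (subst log_le_cancel_iff) (auto intro!: add_pos_nonneg)
  also have "real (n * n * n) = real n ^ 3" by (simp add: power3_eq_cube)
  also have "log 2 (real n ^ 3) = 3 * log 2 (real n)" using assms by (simp add: log_nat_power)
  finally have "log 2 (real (n * n + 2)) \<le> 3 * log 2 (real n)" .
  moreover have "1 \<le> log 2 (real n)" using assms by simp
  moreover have "0 \<le> log 2 (real (n * n + 2))" by (subst zero_le_log_cancel_iff) (auto intro!: add_pos_nonneg)
  then have "real (log_bound n) \<le> log 2 (real (n * n + 2)) + 1"
    unfolding log_bound_def by linarith
  ultimately have "real (log_bound n) \<le> 4 * log 2 (real n)" by simp
  then show ?thesis by (simp add: log_def)
qed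

lemma colour_bits_le_log_bound: "colour_bits L n \<le> log_bound n"
proof (cases "colour_bits L n")
  case (Suc b)
  then have "2 ^ b < 2 * min L n" by (intro colour_bits_less) simp
  also have "\<dots> \<le> n * n + 2"
  proof -
    have "2 * n \<le> n * n + 2" by (cases n) auto
    then show ?thesis by simp
  qed
  also have "\<dots> \<le> 2 ^ log_bound n" by (rule log_bound_ge)
  finally show ?thesis using Suc by simp
qed simp

text \<open>By minimality, half of a power above 1 is less than \<open>2 * min L n\<close>.\<close>

lemma power_colour_bits_le:
  assumes "1 \<le> L"
  shows "2 ^ colour_bits L n \<le> 4 * L"
proof (cases "colour_bits L n")
  case (Suc b)
  then have "2 ^ b < 2 * min L n" by (intro colour_bits_less) simp
  then show ?thesis using Suc by simp
qed (use assms in simp)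

text \<open>The bit graphs are no more numerous than the graphs with deleted colours, so they at
  most double the block.\<close>

lemma block_size_le:
  assumes "1 \<le> L" "1 \<le> f"
  shows "block_size L n f \<le> 2 * (4 ^ f * L ^ f)"
proof -
  have "colour_bits L n < 2 ^ colour_bits L n" by simp
  also have "\<dots> \<le> (2 ^ colour_bits L n) ^ f" using assms(2) by (intro self_le_power) auto
  finally have "block_size L n f \<le> 2 * (2 ^ colour_bits L n) ^ f" by (simp add: block_size_def)
  also have "\<dots> \<le> 2 * (4 * L) ^ f"
    using power_colour_bits_le[OF assms(1)] by (intro mult_left_mono power_mono) auto
  finally show ?thesis by (simp add: power_mult_distrib)
qed

text \<open>The number of rounds \<open>D * N\<close> of \<open>covering_sequence_exists\<close>
  with \<open>D = 4 ^ f\<close> and \<open>N = (f + 1) * log_bound n\<close>.\<close>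

definition num_colourings :: "nat \<Rightarrow> nat \<Rightarrow> nat" where
  "num_colourings f n = 4 ^ f * ((f + 1) * log_bound n)"

lemma num_colourings_le: "1 \<le> f \<Longrightarrow> num_colourings f n \<le> 2 * f * 4 ^ f * log_bound n"
  by (simp add: num_colourings_def)

text \<open>Polynomial factors in \<open>f\<close> are absorbed into an exponential, which is
  subpolynomial in \<open>L\<close> or \<open>n\<close> under the respective growth condition: three
  estimates \<open>f \<le> 2 ^ f\<close> turn \<open>4 ^ f\<close> into
  \<open>32 ^ f\<close>.\<close>

lemma query_steps_le:
  assumes "1 \<le> f"
  shows "query_steps f f (num_colourings f n) (colour_bits L n) \<le> 143 * 32 ^ f * log_bound n ^ 2"
proof -
  let ?b = "log_bound n"
  have b: "1 \<le> ?b" by (rule log_bound_pos)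
  have fb: "1 \<le> f * ?b" "f \<le> f * ?b" "?b \<le> f * ?b" using assms b by auto
  have ffb: "f * f * ?b \<ge> f * f" "f * f * ?b \<ge> f * ?b" using assms b by auto
  have "f * (f * 13 + colour_bits L n * 11 + 18) + 9 \<le> f * (f * 13 + ?b * 11 + 18) + 9"
    using colour_bits_le_log_bound[of L n] by simp
  also have "\<dots> = 13 * (f * f) + 11 * (f * ?b) + 18 * f + 9" by (simp add: algebra_simps)
  \<comment> \<open>51 is 13 + 11 + 18 + 9, as \<open>f * f * ?b\<close> dominates each
    term.\<close>
  also have "\<dots> \<le> 51 * (f * f * ?b)" using fb ffb by linarith
  finally have "num_colourings f n * (f * (f * 13 + colour_bits L n * 11 + 18) + 9) \<le>
      (2 * f * 4 ^ f * ?b) * (51 * (f * f * ?b))" (is "?t \<le> _")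
    using num_colourings_le[OF assms] by (intro mult_mono) auto
  then have "?t \<le> 102 * ((f * 4 ^ f * ?b) * (f * f * ?b))" by (simp add: mult_ac)
  \<comment> \<open>Here 41 is 7 + 4 + 30, and 102 + 41 yields the final 143.\<close>
  moreover have "colour_bits L n * 7 + f * 4 + 30 \<le> 41 * (f * ?b)"
    using fb colour_bits_le_log_bound[of L n] by linarith
  moreover have "f * ?b \<le> (f * 4 ^ f * ?b) * (f * f * ?b)"
  proof -
    have "1 * (f * ?b) \<le> (f * 4 ^ f * ?b) * (f * f * ?b)"
      using assms b ffb by (intro mult_mono) auto
    then show ?thesis by simp
  qed
  ultimately have "query_steps f f (num_colourings f n) (colour_bits L n) \<le>
      143 * ((f * 4 ^ f * ?b) * (f * f * ?b))"
    unfolding query_steps_def by linarith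
  also have "\<dots> = 143 * ((f * f * f) * 4 ^ f * ?b ^ 2)" by (simp add: power2_eq_square mult_ac)
  also have "\<dots> \<le> 143 * ((2 ^ f * 2 ^ f * 2 ^ f) * 4 ^ f * ?b ^ 2)"
    by (intro mult_left_mono mult_right_mono mult_mono) (auto intro: less_imp_le)
  also have "\<dots> = 143 * 32 ^ f * ?b ^ 2" by (simp flip: power_mult_distrib)
  finally show ?thesis .
qed

lemma has_coverings_colours:
  assumes f: "\<forall>n. f n \<ge> 1" and L: "\<forall>n. L n \<ge> 1"
  shows "has_coverings L f
    (\<lambda>n. real (num_colourings (f n) n * block_size (L n) n (f n)))
    (\<lambda>n. real (query_steps (f n) (f n) (num_colourings (f n) n) (colour_bits (L n) n)))
    (\<lambda>n. real (num_colourings (f n) n))"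
  unfolding has_coverings_def
proof (rule exI[of _ "compile 0 query_prog"], rule exI[of _ 4], intro allI impI)
  fix n G assume "wf_wgraph G \<and> nverts G = n"
  then have wf: "wf_wgraph G" and n: "nverts G = n" by auto
  let ?R = "num_colourings (f n) n" and ?b = "colour_bits (L n) n"
  have \<beta>: "nverts G * nverts G + 2 \<le> 2 ^ log_bound n" unfolding n by (rule log_bound_ge)
  obtain hs where hs: "\<forall>r. hs r \<in> edges G \<rightarrow>\<^sub>E {..<2 ^ colour_bits (L n) (nverts G)}"
    and cover: "\<forall>F s t. F \<subseteq> edges G \<and> card F \<le> f n \<and> s < nverts G \<and> t < nverts G \<and>
      (\<exists>p. shortest_path (spanning_sub G (edges G - F)) (arc_weight G) s p t \<and> length p \<le> L n) \<longrightarrow>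
      (\<exists>r<?R. \<exists>P p. P \<subseteq> edges G \<and> separates (f n) (hs r) F P \<and>
        shortest_path (spanning_sub G (edges G - F)) (arc_weight G) s p t \<and> length p \<le> L n \<and>
        (\<forall>H. P \<subseteq> H \<longrightarrow> path_in (spanning_sub G H) s p t))"
    using colourings_exist[OF wf L[rule_format] \<beta>, of n "f n"] unfolding num_colourings_def by blast
  let ?K = "?R * block_size (L n) n (f n)"
  let ?H = "colour_family G (L n) (f n) hs" and ?S = "colour_selection G (L n) (f n) ?R hs"
  have "1 \<le> ?R" using log_bound_pos[of n] by (simp add: num_colourings_def)
  show "\<exists>K H S. replacement_path_covering G (L n) (f n) K H S \<and>
      real K \<le> real ?K \<and>
      (\<forall>F. F \<subseteq> edges G \<and> card F \<le> f n \<longrightarrow> real (card (S F)) \<le> real ?R) \<and>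
      (\<forall>Fs. distinct Fs \<and> set Fs \<subseteq> edges G \<and> length Fs \<le> f n \<longrightarrow>
         (\<exists>T ys. real T \<le> real (query_steps (f n) (f n) ?R ?b) \<and> distinct ys \<and> set ys = S (set Fs) \<and>
            (let xs = query_input G (L n) (f n) K H Fs
             in ram_computes (word_length 4 xs) (compile 0 query_prog) xs T ys)))"
  proof (rule exI[of _ ?K], rule exI[of _ ?H], rule exI[of _ ?S], intro conjI allI impI)
    have "replacement_path_covering G (L n) (f n) (?R * block_size (L n) (nverts G) (f n)) ?H ?S"
      by (rule colour_covering[OF wf hs[rule_format]], rule cover[rule_format], intro conjI)
    then show "replacement_path_covering G (L n) (f n) ?K ?H ?S" unfolding n .
    show "real (card (?S F)) \<le> real ?R" for F
      using card_colour_selection_le by simp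
    fix Fs assume Fs: "distinct Fs \<and> set Fs \<subseteq> edges G \<and> length Fs \<le> f n"
    let ?xs = "query_input G (L n) (f n) ?K ?H Fs"
    let ?T = "query_steps (f n) (length Fs) ?R ?b"
    have "\<exists>ys. distinct ys \<and> set ys = ?S (set Fs) \<and>
        ram_computes (word_length 4 ?xs) (compile 0 query_prog) ?xs ?T ys"
      using query_prog_correct[OF wf hs[rule_format] f[rule_format] \<open>1 \<le> ?R\<close>, of Fs n] Fs
      unfolding n by simp
    \<comment> \<open>The step count grows with the number of failures, so its value at
      \<open>f n\<close> covers every query.\<close>
    moreover have "?T \<le> query_steps (f n) (f n) ?R ?b"
      unfolding query_steps_def using Fs by (intro add_mono mult_mono) auto
    ultimately show "\<exists>T ys. real T \<le> real (query_steps (f n) (f n) ?R ?b) \<and> distinct ys \<and>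
        set ys = ?S (set Fs) \<and>
        (let xs = ?xs in ram_computes (word_length 4 xs) (compile 0 query_prog) xs T ys)"
      unfolding Let_def of_nat_le_iff by metis
  qed simp
qed

section \<open>Asymptotic form of the bounds\<close>

text \<open>Turns an exponential in \<open>f\<close> into a power of \<open>L\<close> or
  \<open>n\<close> whose exponent vanishes when \<open>f\<close> is small against the logarithm of
  that base.\<close>

lemma power_eq_powr_ln:
  fixes l a :: real
  assumes "1 < l" "0 < a"
  shows "a ^ f = l powr (real f * ln a / ln l)"
  using assms by (simp add: powr_def exp_of_nat_mult)

lemma ln_ln_over_ln_tendsto_0: "(\<lambda>n. ln (ln (real n)) / ln (real n)) \<longlonglongrightarrow> 0"
  by (rule filterlim_compose[OF ln_x_over_x_tendsto_0])
    (rule filterlim_compose[OF ln_at_top filterlim_real_sequentially])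

lemma tendsto_imp_smallo_1: "X \<longlonglongrightarrow> (0::real) \<Longrightarrow> X \<in> o(\<lambda>_. 1)"
  by (rule smalloI_tendsto) auto

theorem theorem2:
  fixes f L :: "nat \<Rightarrow> nat"
  assumes "\<forall>n. f n \<ge> 1" and "\<forall>n. L n \<ge> 1"
  shows
    "((\<lambda>n. real (f n)) \<in> o(\<lambda>n. ln (real (L n))) \<longrightarrow>
       (\<exists>cv qt sz \<epsilon>1 \<epsilon>2 \<epsilon>3.
          has_coverings L f cv qt sz \<and>
          \<epsilon>1 \<in> o(\<lambda>_. 1) \<and> \<epsilon>2 \<in> o(\<lambda>_. 1) \<and> \<epsilon>3 \<in> o(\<lambda>_. 1) \<and>
          cv \<in> soft_O (\<lambda>n. real (f n) * real (L n) powr (real (f n) + \<epsilon>1 n)) \<and>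
          qt \<in> soft_O (\<lambda>n. real (f n) powr (5/2) * real (L n) powr \<epsilon>2 n) \<and>
          sz \<in> soft_O (\<lambda>n. real (f n) * real (L n) powr \<epsilon>3 n))) \<and>
     ((\<lambda>n. real (f n)) \<in> o(\<lambda>n. ln (real n)) \<longrightarrow>
       (\<exists>cv qt sz \<epsilon>1 \<epsilon>2 \<epsilon>3.
          has_coverings L f cv qt sz \<and>
          \<epsilon>1 \<in> o(\<lambda>_. 1) \<and> \<epsilon>2 \<in> o(\<lambda>_. 1) \<and> \<epsilon>3 \<in> o(\<lambda>_. 1) \<and>
          cv \<in> O(\<lambda>n. real (L n) ^ f n * real n powr \<epsilon>1 n) \<and>
          qt \<in> O(\<lambda>n. real n powr \<epsilon>2 n) \<and>
          sz \<in> O(\<lambda>n. real n powr \<epsilon>3 n)))"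
proof -
  define cv where "cv n = real (num_colourings (f n) n * block_size (L n) n (f n))" for n
  define qt where "qt n = real (query_steps (f n) (f n) (num_colourings (f n) n) (colour_bits (L n) n))" for n
  define sz where "sz n = real (num_colourings (f n) n)" for n
  define c where "c = 4 / ln (2::real)"
  have f: "1 \<le> f n" and L: "1 \<le> L n" for n using assms by auto
  have coverings: "has_coverings L f cv qt sz"
    unfolding cv_def qt_def sz_def by (rule has_coverings_colours[OF assms])
  have c: "0 < c" by (simp add: c_def)
  have log: "real (log_bound n) \<le> c * ln (real n)" if "2 \<le> n" for n
    unfolding c_def by (rule log_bound_le_ln[OF that])
  have sz_le: "sz n \<le> 2 * c * (real (f n) * 4 ^ f n * ln (real n))" if "2 \<le> n" for n
  proof -
    have "sz n \<le> real (2 * f n * 4 ^ f n * log_bound n)"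
      unfolding sz_def of_nat_le_iff by (rule num_colourings_le[OF f])
    also have "\<dots> = 2 * real (f n) * 4 ^ f n * real (log_bound n)" by simp
    also have "\<dots> \<le> 2 * real (f n) * 4 ^ f n * (c * ln (real n))"
      using log[OF that] by (intro mult_left_mono) auto
    finally show ?thesis by (simp add: mult_ac)
  qed
  have cv_le: "cv n \<le> 4 * c * (real (f n) * 16 ^ f n * real (L n) ^ f n * ln (real n))" if "2 \<le> n" for n
  proof -
    have "cv n = sz n * real (block_size (L n) n (f n))" by (simp add: cv_def sz_def)
    also have "\<dots> \<le> 2 * c * (real (f n) * 4 ^ f n * ln (real n)) * real (2 * (4 ^ f n * L n ^ f n))"
      using sz_le[OF that] block_size_le[OF L f] c that
      by (intro mult_mono of_nat_mono) (auto simp: sz_def)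
    also have "\<dots> = 4 * c * (real (f n) * (4 ^ f n * 4 ^ f n) * real (L n) ^ f n * ln (real n))" by simp
    \<comment> \<open>One factor \<open>4 ^ f\<close> stems from the number of colourings, the other
      from the block size.\<close>
    also have "(4::real) ^ f n * 4 ^ f n = 16 ^ f n" by (simp flip: power_mult_distrib)
    finally show ?thesis .
  qed
  have qt_le: "qt n \<le> 143 * c ^ 2 * (32 ^ f n * ln (real n) ^ 2)" if "2 \<le> n" for n
  proof -
    have "qt n \<le> real (143 * 32 ^ f n * log_bound n ^ 2)"
      unfolding qt_def of_nat_le_iff by (rule query_steps_le[OF f])
    also have "\<dots> = 143 * 32 ^ f n * real (log_bound n) ^ 2" by simp
    also have "\<dots> \<le> 143 * 32 ^ f n * (c * ln (real n)) ^ 2"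
      using log[OF that] by (intro mult_left_mono power_mono) auto
    finally show ?thesis by (simp add: power_mult_distrib mult_ac)
  qed
  have f_le: "real (f n) \<le> 2 ^ f n" for n
    using less_exp[of "f n"] by (metis less_imp_le of_nat_le_iff of_nat_numeral of_nat_power)
  have nonneg: "0 \<le> cv n" "0 \<le> qt n" "0 \<le> sz n" for n by (simp_all add: cv_def qt_def sz_def)

  have part1: "\<exists>cv qt sz \<epsilon>1 \<epsilon>2 \<epsilon>3.
          has_coverings L f cv qt sz \<and>
          \<epsilon>1 \<in> o(\<lambda>_. 1) \<and> \<epsilon>2 \<in> o(\<lambda>_. 1) \<and> \<epsilon>3 \<in> o(\<lambda>_. 1) \<and>
          cv \<in> soft_O (\<lambda>n. real (f n) * real (L n) powr (real (f n) + \<epsilon>1 n)) \<and>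
          qt \<in> soft_O (\<lambda>n. real (f n) powr (5/2) * real (L n) powr \<epsilon>2 n) \<and>
          sz \<in> soft_O (\<lambda>n. real (f n) * real (L n) powr \<epsilon>3 n)"
    if fo: "(\<lambda>n. real (f n)) \<in> o(\<lambda>n. ln (real (L n)))"
  proof -
    \<comment> \<open>The exponent with \<open>real (L n) powr \<epsilon> a n = a ^ f n\<close>
      whenever \<open>L n > 1\<close> and \<open>a > 0\<close>.\<close>
    define \<epsilon> where "\<epsilon> a n = real (f n) * ln a / ln (real (L n))" for a n
    have "(\<lambda>n. real (f n) / ln (real (L n)) * ln a) \<longlonglongrightarrow> 0 * ln a" for a :: real
      by (intro tendsto_mult smalloD_tendsto[OF fo] tendsto_const)
    then have \<epsilon>: "\<epsilon> a \<in> o(\<lambda>_. 1)" for a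
      unfolding \<epsilon>_def by (intro tendsto_imp_smallo_1) (simp add: mult.commute)
    \<comment> \<open>As \<open>f n \<ge> 1\<close>, the growth condition excludes
      \<open>L n = 1\<close> for large \<open>n\<close>, where the denominator of the exponent would
      be 0.\<close>
    have "\<forall>\<^sub>F n in sequentially. norm (real (f n)) \<le> 1 * norm (ln (real (L n)))"
      by (rule landau_o.smallD[OF fo]) simp
    then have ev: "\<forall>\<^sub>F n in sequentially. 1 < real (L n) \<and> 2 \<le> n"
      using eventually_ge_at_top[of 2]
    proof eventually_elim
      case (elim n)
      have "L n \<noteq> 1" using elim(1) f[of n] by auto
      then show ?case using L[of n] elim(2) by simp
    qed
    have pow: "a ^ f n = real (L n) powr \<epsilon> a n" if "1 < real (L n)" "0 < a" for a n
      unfolding \<epsilon>_def by (rule power_eq_powr_ln[OF that])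
    have "cv \<in> O(\<lambda>n. real (f n) * real (L n) powr (real (f n) + \<epsilon> 16 n) * ln (real n) ^ 1)"
    proof (rule bigoI[of _ "4 * c"], use ev in eventually_elim)
      case (elim n)
      then have "real (L n) powr (real (f n) + \<epsilon> 16 n) = real (L n) ^ f n * 16 ^ f n"
        using pow[of n 16] by (simp add: powr_add powr_realpow)
      then show ?case using cv_le[of n] elim nonneg[of n] by (simp add: mult_ac)
    qed
    then have "cv \<in> soft_O (\<lambda>n. real (f n) * real (L n) powr (real (f n) + \<epsilon> 16 n))"
      unfolding soft_O_def by blast
    moreover have "qt \<in> O(\<lambda>n. real (f n) powr (5/2) * real (L n) powr \<epsilon> 32 n * ln (real n) ^ 2)"
    proof (rule bigoI[of _ "143 * c ^ 2"], use ev in eventually_elim)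
      case (elim n)
      \<comment> \<open>The factor \<open>f powr (5/2)\<close> is merely bounded below by 1, since
        \<open>32 ^ f\<close> already covers every polynomial factor in \<open>f\<close>.\<close>
      have "1 \<le> real (f n) powr (5/2)" using f[of n] by (intro ge_one_powr_ge_zero) auto
      then have "1 * (32 ^ f n * ln (real n) ^ 2) \<le> real (f n) powr (5/2) * (32 ^ f n * ln (real n) ^ 2)"
        by (intro mult_right_mono) auto
      then have "143 * c ^ 2 * (32 ^ f n * ln (real n) ^ 2) \<le>
          143 * c ^ 2 * (real (f n) powr (5/2) * (32 ^ f n * ln (real n) ^ 2))"
        by (intro mult_left_mono) auto
      then have "qt n \<le> 143 * c ^ 2 * (real (f n) powr (5/2) * 32 ^ f n * ln (real n) ^ 2)"
        using qt_le[of n] elim by (simp add: mult_ac)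
      then show ?case using nonneg[of n] elim pow[of n 32] by simp
    qed
    then have "qt \<in> soft_O (\<lambda>n. real (f n) powr (5/2) * real (L n) powr \<epsilon> 32 n)"
      unfolding soft_O_def by blast
    moreover have "sz \<in> O(\<lambda>n. real (f n) * real (L n) powr \<epsilon> 4 n * ln (real n) ^ 1)"
    proof (rule bigoI[of _ "2 * c"], use ev in eventually_elim)
      case (elim n)
      then show ?case using sz_le[of n] nonneg[of n] pow[of n 4] by simp
    qed
    then have "sz \<in> soft_O (\<lambda>n. real (f n) * real (L n) powr \<epsilon> 4 n)"
      unfolding soft_O_def by blast
    ultimately show ?thesis using coverings \<epsilon> by blast
  qed

  have part2: "\<exists>cv qt sz \<epsilon>1 \<epsilon>2 \<epsilon>3.
          has_coverings L f cv qt sz \<and>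
          \<epsilon>1 \<in> o(\<lambda>_. 1) \<and> \<epsilon>2 \<in> o(\<lambda>_. 1) \<and> \<epsilon>3 \<in> o(\<lambda>_. 1) \<and>
          cv \<in> O(\<lambda>n. real (L n) ^ f n * real n powr \<epsilon>1 n) \<and>
          qt \<in> O(\<lambda>n. real n powr \<epsilon>2 n) \<and>
          sz \<in> O(\<lambda>n. real n powr \<epsilon>3 n)"
    if fo: "(\<lambda>n. real (f n)) \<in> o(\<lambda>n. ln (real n))"
  proof -
    \<comment> \<open>The bounds grant no polylogarithmic factor here, so the second summand of the
      exponent absorbs \<open>ln n ^ k\<close>.\<close>
    define \<epsilon> where "\<epsilon> k n = real (f n) * ln 32 / ln (real n) + real k * ln (ln (real n)) / ln (real n)"
      for k :: nat and n
    have "(\<lambda>n. real (f n) / ln (real n) * ln 32 + real k * (ln (ln (real n)) / ln (real n)))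
        \<longlonglongrightarrow> 0 * ln 32 + real k * 0" for k
      by (intro tendsto_intros smalloD_tendsto[OF fo] ln_ln_over_ln_tendsto_0)
    then have \<epsilon>: "\<epsilon> k \<in> o(\<lambda>_. 1)" for k
      unfolding \<epsilon>_def by (intro tendsto_imp_smallo_1) (simp add: mult_ac)
    have pow: "real n powr \<epsilon> k n = 32 ^ f n * ln (real n) ^ k" if "2 \<le> n" for k n
    proof -
      have "1 < real n" "0 < ln (real n)" using that by auto
      then show ?thesis
        using power_eq_powr_ln[of "real n" 32 "f n"] power_eq_powr_ln[of "real n" "ln (real n)" k]
        by (simp add: \<epsilon>_def powr_add)
    qed
    \<comment> \<open>Since \<open>f \<le> 2 ^ f\<close>, base 32 covers a factor \<open>f\<close>
      together with any base up to 16; this serves both the covering value and the subfamily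
      size.\<close>
    have le: "real (f n) * a ^ f n * ln (real n) \<le> real n powr \<epsilon> 1 n" if "2 \<le> n" "0 \<le> a" "a \<le> 16" for n a
    proof -
      have "real (f n) * a ^ f n * ln (real n) \<le> 2 ^ f n * 16 ^ f n * ln (real n)"
        using that f_le by (intro mult_right_mono mult_mono power_mono) auto
      also have "(2::real) ^ f n * 16 ^ f n = 32 ^ f n" by (simp flip: power_mult_distrib)
      finally show ?thesis using pow[OF that(1), of 1] by simp
    qed
    have ev: "\<forall>\<^sub>F n in sequentially. 2 \<le> (n::nat)" by (rule eventually_ge_at_top)
    have "cv \<in> O(\<lambda>n. real (L n) ^ f n * real n powr \<epsilon> 1 n)"
    proof (rule bigoI[of _ "4 * c"], use ev in eventually_elim)
      case (elim n)
      have "cv n \<le> 4 * c * (real (L n) ^ f n * (real (f n) * 16 ^ f n * ln (real n)))"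
        using cv_le[OF elim] by (simp add: mult_ac)
      also have "\<dots> \<le> 4 * c * (real (L n) ^ f n * real n powr \<epsilon> 1 n)"
        using le[OF elim, of 16] c by (intro mult_left_mono) auto
      finally show ?case using nonneg[of n] by simp
    qed
    moreover have "qt \<in> O(\<lambda>n. real n powr \<epsilon> 2 n)"
    proof (rule bigoI[of _ "143 * c ^ 2"], use ev in eventually_elim)
      case (elim n)
      then show ?case using qt_le[OF elim] nonneg[of n] pow[OF elim, of 2] by simp
    qed
    moreover have "sz \<in> O(\<lambda>n. real n powr \<epsilon> 1 n)"
    proof (rule bigoI[of _ "2 * c"], use ev in eventually_elim)
      case (elim n)
      have "sz n \<le> 2 * c * (real (f n) * 4 ^ f n * ln (real n))" by (rule sz_le[OF elim])
      also have "\<dots> \<le> 2 * c * real n powr \<epsilon> 1 n"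
        using le[OF elim, of 4] c by (intro mult_left_mono) auto
      finally show ?case using nonneg[of n] by simp
    qed
    ultimately show ?thesis using coverings \<epsilon> by blast
  qed

  show ?thesis using part1 part2 by (intro conjI impI)
qed

end
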